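(* Consider the multi-agent system described in the context, and suppose that (Assumption 1) every $f_{ij}$ is locally strongly convex, admits a minimum, and (without loss of generality) satisfies $f_{ij} \ge 0$; (Assumption 2) for every agent $i$, there are $\alpha, \tau > 0$ such that $|h_i(t, u_i(t))| \geq \alpha |u_i(t)|$ holds on an infinite number of disjoint time intervals of length at least $\tau$. Then every trajectory $y$ of the system converges to a point of $\mathbb{R}^n$ as $t\to\infty$. Moreover, $$\lim_{t\to\infty} y(t) \in S^p := \bigcap_{i=1}^n S_i^p, \qquad S_i^p := \{x \in \mathbb{R}^n : \tilde g_i^-(x) \leq 0 \leq \tilde g_i^+(x)\},$$ where $$\tilde g_i^+(x) := -\sum_{j\sim i} f'_{ij}(x_j - x_i - 2\bar p_{ij}), \qquad \tilde g_i^-(x) := -\sum_{j\sim i} f'_{ij}(x_j - x_i + 2\bar p_{ij}).$$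
   Context: System. There are $n$ agents and a connected undirected graph $G$ on $\{1,\dots,n\}$; $i\sim j$ means that $i$ and $j$ are neighbors in $G$. For every ordered pair $(i,j)$ with $i \sim j$ there is a function $f_{ij}:\mathbb{R}\to\mathbb{R}$, twice differentiable with locally Lipschitz second derivative, satisfying the symmetry condition $f_{ij}(z) = f_{ji}(-z)$, and a known bound $\bar p_{ij}\ge 0$. Agent $i$ has position $y_i(t)\in\mathbb{R}$, and $y=(y_1,\dots,y_n):[0,\infty)\to\mathbb{R}^n$ is absolutely continuous and satisfies, for almost every $t$, $$\dot y_i(t) = h_i(t,u_i(t)),$$ where $h_i$ is an arbitrary function that preserves the sign of $u_i$ but may vanish (so $h_i(t,u)\ge 0$ if $u>0$, $h_i(t,u)\le 0$ if $u<0$, and $h_i(t,0)=0$). The agents' measurements are $$\hat\Delta_{ij}(t) = y_j(t)-y_i(t)+p_{ij}(t) \quad (j\sim i),$$ for arbitrary perturbations $p_{ij}(t)$ with $|p_{ij}(t)|\le \bar p_{ij}$. With $$g_i^+(t) = \sum_{j \sim i} \sup_{p \in [-\bar{p}_{ij}, \bar{p}_{ij}]} -f'_{ij}(\hat{\Delta}_{ij}(t) + p),\qquad g_i^-(t) = \sum_{j \sim i} \inf_{p \in [-\bar{p}_{ij}, \bar{p}_{ij}]} -f'_{ij}(\hat{\Delta}_{ij}(t) + p),$$ the control inputs are $$u_i(t) = -\max(g_i^-(t), 0) - \min(g_i^+(t), 0).$$ A trajectory of the system is any such $y$. A function $f:\mathbb{R}\to\mathbb{R}$ is locally strongly convex if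 on every bounded interval it is strongly convex with some positive modulus; for the functions considered here this means $f''>0$ everywhere. *)

theory Defs
  imports "HOL-Analysis.Analysis" "HOL-Library.Disjoint_Sets"
begin

(* Graphs on the vertex type 'n (the agents) are given by their adjacency relation. *)
definition connected_simple_graph :: "('n \<Rightarrow> 'n \<Rightarrow> bool) \<Rightarrow> bool" where
  "connected_simple_graph nbr \<longleftrightarrow>
     (\<forall>i. \<not> nbr i i) \<and> (\<forall>i j. nbr i j \<longrightarrow> nbr j i) \<and> (\<forall>i j. nbr\<^sup>*\<^sup>* i j)"

definition locally_lipschitz :: "(real \<Rightarrow> real) \<Rightarrow> bool" where
  "locally_lipschitz g \<longleftrightarrow> (\<forall>x. \<exists>e>0. \<exists>L. L-lipschitz_on (ball x e) g)"

definition strongly_convex_on :: "real set \<Rightarrow> real \<Rightarrow> (real \<Rightarrow> real) \<Rightarrow> bool" where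
  "strongly_convex_on S \<mu> g \<longleftrightarrow> convex S \<and>
     (\<forall>x\<in>S. \<forall>y\<in>S. \<forall>\<theta>\<in>{0..1}.
        g (\<theta> * x + (1 - \<theta>) * y)
          \<le> \<theta> * g x + (1 - \<theta>) * g y - \<mu> / 2 * \<theta> * (1 - \<theta>) * (x - y)\<^sup>2)"

definition locally_strongly_convex :: "(real \<Rightarrow> real) \<Rightarrow> bool" where
  "locally_strongly_convex g \<longleftrightarrow>
     (\<forall>J. is_interval J \<and> bounded J \<longrightarrow> (\<exists>\<mu>>0. strongly_convex_on J \<mu> g))"

definition admits_minimum :: "(real \<Rightarrow> real) \<Rightarrow> bool" where
  "admits_minimum g \<longleftrightarrow> (\<exists>z. \<forall>w. g z \<le> g w)"

(* D is a finite family of non-overlapping intervals, each stored as its pair of endpoints. *)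
definition absolutely_continuous_on :: "real set \<Rightarrow> (real \<Rightarrow> 'a::real_normed_vector) \<Rightarrow> bool" where
  "absolutely_continuous_on S g \<longleftrightarrow>
     (\<forall>\<epsilon>>0. \<exists>\<delta>>0. \<forall>D.
        finite D \<and> (\<forall>(a, b)\<in>D. a < b \<and> {a..b} \<subseteq> S) \<and>
        pairwise (\<lambda>(a, b) (c, d). {a<..<b} \<inter> {c<..<d} = {}) D \<and>
        (\<Sum>(a, b)\<in>D. b - a) < \<delta>
        \<longrightarrow> (\<Sum>(a, b)\<in>D. norm (g b - g a)) < \<epsilon>)"

definition measurement ::
  "('n \<Rightarrow> 'n \<Rightarrow> real \<Rightarrow> real) \<Rightarrow> (real \<Rightarrow> real ^ 'n::finite) \<Rightarrow> 'n \<Rightarrow> 'n \<Rightarrow> real \<Rightarrow> real" where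
  "measurement p y i j t = y t $ j - y t $ i + p i j t"

definition g_plus ::
  "('n \<Rightarrow> 'n \<Rightarrow> bool) \<Rightarrow> ('n \<Rightarrow> 'n \<Rightarrow> real \<Rightarrow> real) \<Rightarrow> ('n \<Rightarrow> 'n \<Rightarrow> real) \<Rightarrow>
   ('n \<Rightarrow> 'n \<Rightarrow> real \<Rightarrow> real) \<Rightarrow> (real \<Rightarrow> real ^ 'n::finite) \<Rightarrow> 'n \<Rightarrow> real \<Rightarrow> real" where
  "g_plus nbr f pbar p y i t =
     (\<Sum>j | nbr i j. SUP q\<in>{- pbar i j .. pbar i j}. - deriv (f i j) (measurement p y i j t + q))"

definition g_minus ::
  "('n \<Rightarrow> 'n \<Rightarrow> bool) \<Rightarrow> ('n \<Rightarrow> 'n \<Rightarrow> real \<Rightarrow> real) \<Rightarrow> ('n \<Rightarrow> 'n \<Rightarrow> real) \<Rightarrow>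
   ('n \<Rightarrow> 'n \<Rightarrow> real \<Rightarrow> real) \<Rightarrow> (real \<Rightarrow> real ^ 'n::finite) \<Rightarrow> 'n \<Rightarrow> real \<Rightarrow> real" where
  "g_minus nbr f pbar p y i t =
     (\<Sum>j | nbr i j. INF q\<in>{- pbar i j .. pbar i j}. - deriv (f i j) (measurement p y i j t + q))"

definition control ::
  "('n \<Rightarrow> 'n \<Rightarrow> bool) \<Rightarrow> ('n \<Rightarrow> 'n \<Rightarrow> real \<Rightarrow> real) \<Rightarrow> ('n \<Rightarrow> 'n \<Rightarrow> real) \<Rightarrow>
   ('n \<Rightarrow> 'n \<Rightarrow> real \<Rightarrow> real) \<Rightarrow> (real \<Rightarrow> real ^ 'n::finite) \<Rightarrow> 'n \<Rightarrow> real \<Rightarrow> real" where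
  "control nbr f pbar p y i t =
     - max (g_minus nbr f pbar p y i t) 0 - min (g_plus nbr f pbar p y i t) 0"

(* y is a trajectory under the perturbations p.  Absolute continuity on [0, \<infinity>) is required on
   every compact interval [0, T] (the usual notion for Caratheodory solutions). *)
definition trajectory ::
  "('n \<Rightarrow> 'n \<Rightarrow> bool) \<Rightarrow> ('n \<Rightarrow> 'n \<Rightarrow> real \<Rightarrow> real) \<Rightarrow> ('n \<Rightarrow> 'n \<Rightarrow> real) \<Rightarrow>
   ('n \<Rightarrow> real \<Rightarrow> real \<Rightarrow> real) \<Rightarrow>
   ('n \<Rightarrow> 'n \<Rightarrow> real \<Rightarrow> real) \<Rightarrow> (real \<Rightarrow> real ^ 'n::finite) \<Rightarrow> bool" where
  "trajectory nbr f pbar h p y \<longleftrightarrow>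
     (\<forall>i j t. nbr i j \<and> 0 \<le> t \<longrightarrow> \<bar>p i j t\<bar> \<le> pbar i j) \<and>
     (\<forall>T\<ge>0. absolutely_continuous_on {0..T} y) \<and>
     (AE t in lborel. 0 \<le> t \<longrightarrow>
        (\<forall>i. ((\<lambda>s. y s $ i) has_real_derivative h i t (control nbr f pbar p y i t))
               (at t within {0..})))"

definition sign_preserving :: "(real \<Rightarrow> real \<Rightarrow> real) \<Rightarrow> bool" where
  "sign_preserving k \<longleftrightarrow>
     (\<forall>t\<ge>0. (\<forall>u>0. 0 \<le> k t u) \<and> (\<forall>u<0. k t u \<le> 0) \<and> k t 0 = 0)"

(* is_interval admits open, closed, half-open and unbounded J; the length of J is its Lebesgue
   measure. *)
definition recurrently_active :: "(real \<Rightarrow> real \<Rightarrow> real) \<Rightarrow> (real \<Rightarrow> real) \<Rightarrow> bool" where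
  "recurrently_active k u \<longleftrightarrow>
     (\<exists>\<alpha>>0. \<exists>\<tau>>0. \<exists>\<J>. infinite \<J> \<and> disjoint \<J> \<and>
        (\<forall>J\<in>\<J>. is_interval J \<and> J \<subseteq> {0..} \<and> ennreal \<tau> \<le> emeasure lborel J \<and>
           (\<forall>t\<in>J. \<alpha> * \<bar>u t\<bar> \<le> \<bar>k t (u t)\<bar>)))"

definition gt_plus ::
  "('n \<Rightarrow> 'n \<Rightarrow> bool) \<Rightarrow> ('n \<Rightarrow> 'n \<Rightarrow> real \<Rightarrow> real) \<Rightarrow> ('n \<Rightarrow> 'n \<Rightarrow> real) \<Rightarrow>
   'n \<Rightarrow> real ^ 'n::finite \<Rightarrow> real" where
  "gt_plus nbr f pbar i x = - (\<Sum>j | nbr i j. deriv (f i j) (x $ j - x $ i - 2 * pbar i j))"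

definition gt_minus ::
  "('n \<Rightarrow> 'n \<Rightarrow> bool) \<Rightarrow> ('n \<Rightarrow> 'n \<Rightarrow> real \<Rightarrow> real) \<Rightarrow> ('n \<Rightarrow> 'n \<Rightarrow> real) \<Rightarrow>
   'n \<Rightarrow> real ^ 'n::finite \<Rightarrow> real" where
  "gt_minus nbr f pbar i x = - (\<Sum>j | nbr i j. deriv (f i j) (x $ j - x $ i + 2 * pbar i j))"

definition Sp_agent ::
  "('n \<Rightarrow> 'n \<Rightarrow> bool) \<Rightarrow> ('n \<Rightarrow> 'n \<Rightarrow> real \<Rightarrow> real) \<Rightarrow> ('n \<Rightarrow> 'n \<Rightarrow> real) \<Rightarrow>
   'n \<Rightarrow> (real ^ 'n::finite) set" where
  "Sp_agent nbr f pbar i = {x. gt_minus nbr f pbar i x \<le> 0 \<and> 0 \<le> gt_plus nbr f pbar i x}"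

definition Sp ::
  "('n \<Rightarrow> 'n \<Rightarrow> bool) \<Rightarrow> ('n \<Rightarrow> 'n \<Rightarrow> real \<Rightarrow> real) \<Rightarrow> ('n \<Rightarrow> 'n \<Rightarrow> real) \<Rightarrow>
   (real ^ 'n::finite) set" where
  "Sp nbr f pbar = (\<Inter>i. Sp_agent nbr f pbar i)"

end

theory Submission
  imports Defs
begin

text \<open>
  Let $V$ be half the sum of the $f_{ij}(x_j - x_i)$ over all ordered pairs of neighbours. As $g_i^-$
  and $g_i^+$ bracket $\partial_i V(y)$, every velocity opposes the corresponding partial derivative,
  so $V$ decreases along the trajectory at rate at least $|\partial_i V(y)| |\dot y_i|$ for each $i$.

  The heart of the proof is a maximum principle. At an index maximising $y_i - x_i$, monotonicity of
  the $f'_{ij}$ gives $\partial_i V(y) \ge \partial_i V(x)$; if $\partial_i V(x) = 0$, the agent $i$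
  therefore does not move upwards. If instead $K |\partial_i V(y)| \ge 1$, the motion of $i$ is paid
  for by the decrease of $K V$. Thus $\max_i |y_i - x_i| + K V(y)$ is nonincreasing as long as each
  $i$ is in one of these two cases. With $x$ a minimiser of $V$ and $K = 0$ this shows that $y$ is
  bounded. With $x$ a limit point of $y$ and $K$ large it holds while $y$ is near $x$, so $y$ cannot
  leave a small neighbourhood of $x$ and converges to it.

  If the limit violated one of the inequalities defining $S^p_i$, the control $u_i$ would eventually
  have constant sign and be bounded away from $0$, and agent $i$ would travel at least a fixed
  distance in each of infinitely many intervals.
\<close>

section \<open>Absolutely continuous functions\<close>

lemma absolutely_continuous_on_subset:
  assumes "absolutely_continuous_on S g" "T \<subseteq> S"
  shows "absolutely_continuous_on T g"
  unfolding absolutely_continuous_on_def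
proof (intro allI impI)
  fix \<epsilon> :: real assume eps: "\<epsilon> > 0"
  obtain \<delta> where "\<delta> > 0" and \<delta>: "\<forall>D. finite D \<and> (\<forall>(a, b)\<in>D. a < b \<and> {a..b} \<subseteq> S) \<and>
        pairwise (\<lambda>(a, b) (c, d). {a<..<b} \<inter> {c<..<d} = {}) D \<and>
        (\<Sum>(a, b)\<in>D. b - a) < \<delta> \<longrightarrow> (\<Sum>(a, b)\<in>D. norm (g b - g a)) < \<epsilon>"
    using assms(1)[unfolded absolutely_continuous_on_def, rule_format, OF eps] by (elim exE conjE)
  show "\<exists>\<delta>>0. \<forall>D. finite D \<and> (\<forall>(a, b)\<in>D. a < b \<and> {a..b} \<subseteq> T) \<and>
        pairwise (\<lambda>(a, b) (c, d). {a<..<b} \<inter> {c<..<d} = {}) D \<and>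
        (\<Sum>(a, b)\<in>D. b - a) < \<delta> \<longrightarrow> (\<Sum>(a, b)\<in>D. norm (g b - g a)) < \<epsilon>"
  proof (intro exI[of _ \<delta>] conjI allI impI \<open>\<delta> > 0\<close>, elim conjE)
    fix D :: "(real \<times> real) set"
    assume "finite D" and D: "\<forall>(a, b)\<in>D. a < b \<and> {a..b} \<subseteq> T"
      and "pairwise (\<lambda>(a, b) (c, d). {a<..<b} \<inter> {c<..<d} = {}) D" "(\<Sum>(a, b)\<in>D. b - a) < \<delta>"
    moreover have "\<forall>(a, b)\<in>D. a < b \<and> {a..b} \<subseteq> S"
    proof clarify
      fix c d assume "(c, d) \<in> D"
      with D have "c < d \<and> {c..d} \<subseteq> T" by blast
      with assms(2) show "c < d \<and> {c..d} \<subseteq> S" by blast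
    qed
    ultimately show "(\<Sum>(a, b)\<in>D. norm (g b - g a)) < \<epsilon>"
      by (intro \<delta>[THEN spec, THEN mp] conjI)
  qed
qed

lemma absolutely_continuous_on_imp_continuous_on:
  assumes "absolutely_continuous_on {a..b} g"
  shows "continuous_on {a..b} g"
  unfolding continuous_on_iff
proof (intro ballI allI impI)
  fix x e :: real assume x: "x \<in> {a..b}" and "e > 0"
  obtain \<delta> where "\<delta> > 0" and \<delta>: "\<forall>D. finite D \<and> (\<forall>(c, d)\<in>D. c < d \<and> {c..d} \<subseteq> {a..b}) \<and>
        pairwise (\<lambda>(a, b) (c, d). {a<..<b} \<inter> {c<..<d} = {}) D \<and>
        (\<Sum>(a, b)\<in>D. b - a) < \<delta> \<longrightarrow> (\<Sum>(a, b)\<in>D. norm (g b - g a)) < e"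
    using assms[unfolded absolutely_continuous_on_def, rule_format, OF \<open>e > 0\<close>] by (elim exE conjE)
  have *: "dist (g d) (g c) < e" if "c < d" "c \<in> {a..b}" "d \<in> {a..b}" "d - c < \<delta>" for c d
    using \<delta>[THEN spec, of "{(c, d)}"] that by (simp add: dist_norm)
  have "dist (g z) (g x) < e" if "z \<in> {a..b}" "dist z x < \<delta>" for z
    using *[of x z] *[of z x] x that \<open>e > 0\<close>
    by (cases z x rule: linorder_cases) (auto simp: dist_commute dist_real_def)
  with \<open>\<delta> > 0\<close> show "\<exists>d>0. \<forall>z\<in>{a..b}. dist z x < d \<longrightarrow> dist (g z) (g x) < e"
    by blast
qed

text \<open>A gauge argument in place of the fundamental theorem of calculus. \<open>\<phi>\<close>
  need not be differentiable: \<open>loc\<close> only bounds increments across \<open>t\<close>,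
  which suits a maximum of several functions, and \<open>lip\<close> transfers absolute continuity
  from \<open>y\<close>.\<close>

lemma absolutely_continuous_descent:
  fixes y :: "real \<Rightarrow> 'a::real_normed_vector" and \<phi> :: "real \<Rightarrow> real"
  assumes "a \<le> b"
    and ac: "absolutely_continuous_on {a..b} y"
    and lip: "\<And>u v. u \<in> {a..b} \<Longrightarrow> v \<in> {a..b} \<Longrightarrow> \<bar>\<phi> v - \<phi> u\<bar> \<le> L * (norm (y v - y u) + \<bar>v - u\<bar>)"
    and N: "N \<in> null_sets lborel"
    and loc: "\<And>t e. t \<in> {a..b} - N \<Longrightarrow> e > 0 \<Longrightarrow>
      \<exists>d>0. \<forall>u\<in>{a..t}. \<forall>v\<in>{t..b}. v - u < d \<longrightarrow> \<phi> v - \<phi> u \<le> e * (v - u)"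
  shows "\<phi> b \<le> \<phi> a"
proof -
  have eps: "\<phi> b - \<phi> a \<le> e" if "e > 0" for e
  proof -
    \<comment> \<open>Two error sources get \<open>e / 2\<close> each: tags in \<open>N\<close> cost
      at most \<open>\<bar>L\<bar> * (2 * e1)\<close>, and the local estimate at most
      \<open>e2 * (b - a)\<close>. The added 1 keeps the denominators positive.\<close>
    define e1 where "e1 = e / (4 * (\<bar>L\<bar> + 1))"
    define e2 where "e2 = e / (2 * (b - a + 1))"
    have e1: "e1 > 0" and e2: "e2 > 0"
      using \<open>e > 0\<close> \<open>a \<le> b\<close> by (auto simp: e1_def e2_def)
    obtain \<delta> where "\<delta> > 0" and \<delta>: "\<forall>D. finite D \<and> (\<forall>(a', b')\<in>D. a' < b' \<and> {a'..b'} \<subseteq> {a..b}) \<and>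
        pairwise (\<lambda>(a, b) (c, d). {a<..<b} \<inter> {c<..<d} = {}) D \<and>
        (\<Sum>(a, b)\<in>D. b - a) < \<delta> \<longrightarrow> (\<Sum>(a, b)\<in>D. norm (y b - y a)) < e1"
      using ac[unfolded absolutely_continuous_on_def, rule_format, OF e1] by (elim exE conjE)
    have N': "N \<in> null_sets lebesgue"
      using N by (simp add: null_sets_completionI)
    \<comment> \<open>The bound \<open>\<delta>\<close> serves absolute continuity, the bound
      \<open>e1\<close> the summand \<open>\<bar>v - u\<bar>\<close> of \<open>lip\<close>.\<close>
    obtain U where U: "open U" "N \<subseteq> U" "emeasure lebesgue (U - N) < ennreal (min \<delta> e1)"
      using sets_lebesgue_outer_open[of N "min \<delta> e1"] \<open>\<delta> > 0\<close> e1 null_setsD2[OF N'] by (metis min_less_iff_conj)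
    have Ule: "emeasure lborel U < ennreal (min \<delta> e1)"
      using U N' by (simp add: emeasure_Diff_null_set)
    txt \<open>A gauge whose tags in the null set $N$ force the subinterval into the small open set $U$,
      where absolute continuity applies; at all other tags the local estimate applies.\<close>
    define d where "d t e = (SOME d. d > 0 \<and> (\<forall>u\<in>{a..t}. \<forall>v\<in>{t..b}. v - u < d \<longrightarrow> \<phi> v - \<phi> u \<le> e * (v - u)))" for t e
    have d: "d t e2 > 0 \<and> (\<forall>u\<in>{a..t}. \<forall>v\<in>{t..b}. v - u < d t e2 \<longrightarrow> \<phi> v - \<phi> u \<le> e2 * (v - u))"
      if "t \<in> {a..b} - N" for t
      unfolding d_def by (rule someI_ex) (use loc[OF that e2] in blast)
    define \<gamma> where "\<gamma> t = (if t \<in> N then U else if t \<in> {a..b} then ball t (d t e2 / 2) else UNIV)" for t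
    have "gauge \<gamma>"
      unfolding gauge_def \<gamma>_def using U d by (auto simp: field_simps)
    then obtain P where P: "P tagged_division_of {a..b}" "\<gamma> fine P"
      using fine_division_exists_real by blast
    note PD = tagged_division_ofD[OF P(1)]
    have Pint: "\<exists>u v. K = {u..v} \<and> u \<le> x \<and> x \<le> v \<and> a \<le> u \<and> v \<le> b \<and> Inf K = u \<and> Sup K = v" if xK: "(x, K) \<in> P" for x K
    proof -
      obtain u v where K: "K = {u..v}" using PD(4)[OF xK] by auto
      with PD(2,3)[OF xK] show ?thesis by (auto intro!: exI[of _ u] exI[of _ v])
    qed
    \<comment> \<open>Degenerate intervals are left out: they carry no increment, absolute
      continuity asks for proper intervals, and endpoint pairs of degenerate intervals may
      coincide.\<close>
    define Q where "Q = {(x, K) \<in> P. x \<in> N \<and> Inf K < Sup K}"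
    have "Q \<subseteq> P" by (auto simp: Q_def)
    have "finite Q" using PD(1) \<open>Q \<subseteq> P\<close> finite_subset by blast
    define E where "E = (\<lambda>(x::real, K::real set). (Inf K, Sup K))"
    have disj: "{Inf K<..<Sup K} \<inter> {Inf K'<..<Sup K'} = {}"
      if xK: "(x, K) \<in> P" "(x', K') \<in> P" "(x, K) \<noteq> (x', K')" for x K x' K'
    proof -
      obtain u v u' v' where "K = {u..v}" "Inf K = u" "Sup K = v"
        "K' = {u'..v'}" "Inf K' = u'" "Sup K' = v'"
        using Pint[OF xK(1)] Pint[OF xK(2)] by blast
      with PD(5)[OF xK] show ?thesis by (simp only: interior_atLeastAtMost_real)
    qed
    have inj: "inj_on E Q"
    proof (rule inj_onI)
      fix q q' assume q: "q \<in> Q" "q' \<in> Q" "E q = E q'"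
      obtain x K x' K' where qq: "q = (x, K)" "q' = (x', K')" by (cases q, cases q') auto
      show "q = q'"
      proof (rule ccontr)
        assume "q \<noteq> q'"
        then have "{Inf K<..<Sup K} \<inter> {Inf K'<..<Sup K'} = {}"
          using disj q qq \<open>Q \<subseteq> P\<close> by blast
        moreover have "Inf K = Inf K'" "Sup K = Sup K'" using q(3) qq by (auto simp: E_def)
        ultimately have "{Inf K<..<Sup K} = {}" by auto
        moreover have "Inf K < Sup K" using q(1) qq by (auto simp: Q_def)
        ultimately show False by (simp add: greaterThanLessThan_empty_iff)
      qed
    qed
    have sumE: "sum g (E ` Q) = (\<Sum>(x,K)\<in>Q. g (Inf K, Sup K))" for g :: "real \<times> real \<Rightarrow> real"
      by (subst sum.reindex[OF inj]) (simp add: E_def split_def)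
    \<comment> \<open>The open cores are disjoint and lie in \<open>U\<close>, so their total length
      is at most the measure of \<open>U\<close>.\<close>
    have "ennreal (\<Sum>(x,K)\<in>Q. Sup K - Inf K) = (\<Sum>(x,K)\<in>Q. emeasure lborel {Inf K<..<Sup K})"
      by (subst sum_ennreal[symmetric]) (auto simp: Q_def intro!: sum.cong)
    also have "\<dots> = emeasure lborel (\<Union>(x,K)\<in>Q. {Inf K<..<Sup K})"
      unfolding split_def
    proof (rule sum_emeasure)
      show "disjoint_family_on (\<lambda>q. {Inf (snd q)<..<Sup (snd q)}) Q"
        using disj \<open>Q \<subseteq> P\<close> unfolding disjoint_family_on_def by (metis prod.collapse subsetD)
    qed (use \<open>finite Q\<close> in auto)
    also have "\<dots> \<le> emeasure lborel U"
    proof (rule emeasure_mono)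
      show "(\<Union>(x,K)\<in>Q. {Inf K<..<Sup K}) \<subseteq> U"
      proof clarify
        fix z x K assume *: "(x, K) \<in> Q" "z \<in> {Inf K<..<Sup K}"
        then have "K \<subseteq> U" using fineD[OF P(2), of x K] by (simp add: Q_def \<gamma>_def)
        moreover have "\<exists>u v. K = {u..v} \<and> Inf K = u \<and> Sup K = v"
          using * Pint[of x K] by (auto simp: Q_def)
        ultimately show "z \<in> U" using *(2) by auto
      qed
    qed (use U in auto)
    finally have less: "ennreal (\<Sum>(x,K)\<in>Q. Sup K - Inf K) < ennreal (min \<delta> e1)" using Ule by order
    have len: "(\<Sum>(x,K)\<in>Q. Sup K - Inf K) < min \<delta> e1"
    proof (rule ccontr)
      assume "\<not> ?thesis"
      then have "ennreal (min \<delta> e1) \<le> ennreal (\<Sum>(x,K)\<in>Q. Sup K - Inf K)"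
        by (intro ennreal_leI) (simp only: not_less)
      with less show False by order
    qed
    have "(\<Sum>(a, b)\<in>E ` Q. norm (y b - y a)) < e1"
    proof (rule \<delta>[THEN spec, THEN mp], intro conjI)
      show "finite (E ` Q)" using \<open>finite Q\<close> by simp
      show "\<forall>(a', b')\<in>E ` Q. a' < b' \<and> {a'..b'} \<subseteq> {a..b}"
      proof clarify
        fix u v x K assume *: "(u, v) = E (x, K)" "(x, K) \<in> Q"
        then have "a \<le> Inf K" "Sup K \<le> b"
          using Pint[of x K] by (auto simp: Q_def)
        with * show "u < v \<and> {u..v} \<subseteq> {a..b}"
          by (simp add: Q_def E_def)
      qed
      show "pairwise (\<lambda>(a, b) (c, d). {a<..<b} \<inter> {c<..<d} = {}) (E ` Q)"
      proof (rule pairwiseI)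
        fix q q' assume "q \<in> E ` Q" "q' \<in> E ` Q" "q \<noteq> q'"
        then obtain r r' where r: "q = E r" "q' = E r'" "r \<in> P" "r' \<in> P" "r \<noteq> r'"
          using \<open>Q \<subseteq> P\<close> by blast
        then have "{Inf (snd r)<..<Sup (snd r)} \<inter> {Inf (snd r')<..<Sup (snd r')} = {}"
          by (intro disj[of "fst r" _ "fst r'"]) auto
        then show "(\<lambda>(a, b) (c, d). {a<..<b} \<inter> {c<..<d} = {}) q q'"
          by (simp only: r E_def split_def fst_conv snd_conv)
      qed
      show "(\<Sum>(a, b)\<in>E ` Q. b - a) < \<delta>"
        using len by (simp add: sumE split_def)
    qed
    then have "(\<Sum>(x,K)\<in>Q. norm (y (Sup K) - y (Inf K))) < e1"
      by (simp add: sumE split_def)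
    with len have "(\<Sum>(x,K)\<in>Q. norm (y (Sup K) - y (Inf K)) + (Sup K - Inf K)) < 2 * e1"
      by (simp add: sum.distrib split_def)
    then have "\<bar>L\<bar> * (\<Sum>(x,K)\<in>Q. norm (y (Sup K) - y (Inf K)) + (Sup K - Inf K)) \<le> \<bar>L\<bar> * (2 * e1)"
      by (intro mult_left_mono) auto
    also have "\<dots> \<le> e / 2"
      using \<open>e > 0\<close> by (simp add: e1_def field_simps)
    finally have Q_le: "\<bar>L\<bar> * (\<Sum>(x,K)\<in>Q. norm (y (Sup K) - y (Inf K)) + (Sup K - Inf K)) \<le> e / 2" .
    have "\<phi> b - \<phi> a = (\<Sum>(x,K)\<in>P. \<phi> (Sup K) - \<phi> (Inf K))"
      using additive_tagged_division_1[OF \<open>a \<le> b\<close> P(1), of \<phi>] by simp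
    also have "\<dots> \<le> (\<Sum>(x,K)\<in>P. (if (x, K) \<in> Q then \<bar>L\<bar> * (norm (y (Sup K) - y (Inf K)) + (Sup K - Inf K)) else 0)
        + e2 * (Sup K - Inf K))"
    proof (rule sum_mono, clarify)
      fix x K assume xK: "(x, K) \<in> P"
      from Pint[OF xK] obtain u v where K: "K = {u..v}" "u \<le> x" "x \<le> v" "a \<le> u" "v \<le> b"
        "Inf K = u" "Sup K = v" by blast
      show "\<phi> (Sup K) - \<phi> (Inf K) \<le> (if (x, K) \<in> Q then \<bar>L\<bar> * (norm (y (Sup K) - y (Inf K)) + (Sup K - Inf K)) else 0)
        + e2 * (Sup K - Inf K)"
      proof (cases "x \<in> N")
        case True
        have *: "\<phi> v - \<phi> u \<le> \<bar>L\<bar> * (norm (y v - y u) + (v - u))"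
          using lip[of u v] K mult_right_mono[of L "\<bar>L\<bar>" "norm (y v - y u) + (v - u)"] by fastforce
        have "0 \<le> e2 * (v - u)" using e2 K by simp
        have "\<phi> v - \<phi> u \<le> e2 * (v - u)" if "\<not> u < v"
        proof -
          have "u = v" using K that by simp
          then show ?thesis by simp
        qed
        with \<open>0 \<le> e2 * (v - u)\<close> show ?thesis using * True xK K by (cases "u < v") (auto simp: Q_def)
      next
        case False
        have "K \<subseteq> ball x (d x e2 / 2)"
          using fineD[OF P(2) xK] False K by (simp add: \<gamma>_def)
        moreover have "u \<in> K" "v \<in> K" using K by auto
        ultimately have "u \<in> ball x (d x e2 / 2)" "v \<in> ball x (d x e2 / 2)" by auto
        then have "v - u < d x e2" unfolding mem_ball dist_real_def by linarith
        then have "\<phi> v - \<phi> u \<le> e2 * (v - u)"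
          using d[of x] False K by auto
        with False K show ?thesis by (auto simp: Q_def)
      qed
    qed
    also have "\<dots> = (\<Sum>(x,K)\<in>P. if (x, K) \<in> Q then \<bar>L\<bar> * (norm (y (Sup K) - y (Inf K)) + (Sup K - Inf K)) else 0)
        + e2 * (\<Sum>(x,K)\<in>P. Sup K - Inf K)"
      by (simp add: sum.distrib split_def sum_distrib_left)
    also have "(\<Sum>(x,K)\<in>P. Sup K - Inf K) = b - a"
      using additive_tagged_division_1[OF \<open>a \<le> b\<close> P(1), of "\<lambda>x. x"] by simp
    also have "(\<Sum>(x,K)\<in>P. if (x, K) \<in> Q then \<bar>L\<bar> * (norm (y (Sup K) - y (Inf K)) + (Sup K - Inf K)) else 0)
        = (\<Sum>(x,K)\<in>Q. \<bar>L\<bar> * (norm (y (Sup K) - y (Inf K)) + (Sup K - Inf K)))"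
      using PD(1) \<open>Q \<subseteq> P\<close> by (simp add: split_def sum.If_cases Int_absorb1)
    also have "\<dots> = \<bar>L\<bar> * (\<Sum>(x,K)\<in>Q. norm (y (Sup K) - y (Inf K)) + (Sup K - Inf K))"
      by (simp add: split_def sum_distrib_left)
    also have "\<dots> + e2 * (b - a) \<le> e / 2 + e / 2"
    proof (rule add_mono[OF Q_le])
      show "e2 * (b - a) \<le> e / 2"
        using \<open>e > 0\<close> \<open>a \<le> b\<close> by (simp add: e2_def field_simps)
    qed
    finally show ?thesis by simp
  qed
  show ?thesis
  proof (rule field_le_epsilon)
    show "\<phi> b \<le> \<phi> a + e" if "e > 0" for e
      using eps[OF that] by linarith
  qed
qed

text \<open>The straddle lemma: since \<open>u\<close> and \<open>v\<close> lie on opposite sides of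
  \<open>t\<close>, the errors \<open>e * (t - u)\<close> and \<open>e * (v - t)\<close> add up to
  exactly \<open>e * (v - u)\<close>.\<close>

lemma has_real_derivative_straddle:
  fixes w :: "real \<Rightarrow> real"
  assumes "(w has_real_derivative D) (at t within S)" "D \<le> 0" "e > 0" "t \<in> S"
  shows "\<exists>d>0. \<forall>u\<in>S. \<forall>v\<in>S. u \<le> t \<and> t \<le> v \<and> v - u < d \<longrightarrow> w v - w u \<le> e * (v - u)"
proof -
  obtain d where "d > 0" and
    d: "\<And>s. s \<in> S \<Longrightarrow> \<bar>s - t\<bar> < d \<Longrightarrow> \<bar>w s - w t - D * (s - t)\<bar> \<le> e * \<bar>s - t\<bar>"
    using assms(1,3) unfolding has_field_derivative_def has_derivative_within_alt real_norm_def by blast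
  have "w v - w u \<le> e * (v - u)" if "u \<in> S" "v \<in> S" "u \<le> t" "t \<le> v" "v - u < d" for u v
  proof -
    have "w v - w t - D * (v - t) \<le> e * (v - t)" "w t - w u - D * (t - u) \<le> e * (t - u)"
      using d[of v] d[of u] that by (auto simp: abs_le_iff algebra_simps)
    moreover have "D * (v - u) \<le> 0"
      using that \<open>D \<le> 0\<close> by (intro mult_nonpos_nonneg) auto
    ultimately show ?thesis by (simp add: algebra_simps)
  qed
  with \<open>d > 0\<close> show ?thesis by blast
qed

text \<open>The sign of the derivative is only required of the functions that attain the maximum.\<close>

lemma absolutely_continuous_max_descent:
  fixes y :: "real \<Rightarrow> 'a::real_normed_vector" and w :: "'k::finite \<Rightarrow> real \<Rightarrow> real"
  assumes "a \<le> b"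
    and ac: "absolutely_continuous_on {a..b} y"
    and lip: "\<And>k u v. u \<in> {a..b} \<Longrightarrow> v \<in> {a..b} \<Longrightarrow>
      \<bar>w k v - w k u\<bar> \<le> L * (norm (y v - y u) + \<bar>v - u\<bar>)"
    and N: "N \<in> null_sets lborel"
    and der: "\<And>t k. t \<in> {a..b} - N \<Longrightarrow> (w k has_real_derivative w' k t) (at t within {a..b})"
    and active: "\<And>t k. t \<in> {a..b} - N \<Longrightarrow> (\<And>j. w j t \<le> w k t) \<Longrightarrow> w' k t \<le> 0"
    and init: "\<And>k. w k a \<le> B"
  shows "w k b \<le> B"
proof -
  define \<phi> where "\<phi> t = Max (range (\<lambda>k. w k t))" for t
  have w_le: "w k t \<le> \<phi> t" for k t
    unfolding \<phi>_def by (rule Max_ge) auto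
  have \<phi>_eq: "\<exists>k. \<phi> t = w k t" for t
  proof -
    have "\<phi> t \<in> range (\<lambda>k. w k t)"
      unfolding \<phi>_def by (rule Max_in) auto
    then show ?thesis by blast
  qed
  have "\<phi> b \<le> \<phi> a"
  proof (rule absolutely_continuous_descent[OF \<open>a \<le> b\<close> ac _ N])
    have *: "\<phi> v - \<phi> u \<le> L * (norm (y v - y u) + \<bar>v - u\<bar>)" if "u \<in> {a..b}" "v \<in> {a..b}" for u v
    proof -
      obtain k where "\<phi> v = w k v" using \<phi>_eq by blast
      with w_le[of k u] lip[OF that, of k] show ?thesis by linarith
    qed
    show "\<bar>\<phi> v - \<phi> u\<bar> \<le> L * (norm (y v - y u) + \<bar>v - u\<bar>)" if "u \<in> {a..b}" "v \<in> {a..b}" for u v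
      using *[OF that] *[OF that(2,1)] by (simp add: norm_minus_commute abs_minus_commute abs_le_iff)
  next
    fix t e :: real assume t: "t \<in> {a..b} - N" and "e > 0"
    \<comment> \<open>An index that is maximal at \<open>t\<close> has
      \<open>w' k t \<le> 0\<close>; any other index stays strictly below some \<open>w j\<close>
      near \<open>t\<close>, so the premise \<open>w k v = \<phi> v\<close> fails.\<close>
    have "\<exists>d>0. \<forall>u\<in>{a..t}. \<forall>v\<in>{t..b}. v - u < d \<longrightarrow> (w k v = \<phi> v \<longrightarrow> w k v - w k u \<le> e * (v - u))" for k
    proof (cases "\<forall>j. w j t \<le> w k t")
      case True
      obtain d where "d > 0" "\<forall>u\<in>{a..b}. \<forall>v\<in>{a..b}. u \<le> t \<and> t \<le> v \<and> v - u < d \<longrightarrow> w k v - w k u \<le> e * (v - u)"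
        using has_real_derivative_straddle[OF der[OF t] active[OF t] \<open>e > 0\<close>] True t by blast
      then have "\<forall>u\<in>{a..t}. \<forall>v\<in>{t..b}. v - u < d \<longrightarrow> w k v - w k u \<le> e * (v - u)"
        using t by auto
      with \<open>d > 0\<close> show ?thesis by blast
    next
      case False
      then obtain j where j: "w k t < w j t" by (auto simp: not_le)
      have "(w k \<longlongrightarrow> w k t) (at t within {a..b})" "(w j \<longlongrightarrow> w j t) (at t within {a..b})"
        using der[OF t] DERIV_continuous continuous_within by blast+
      then have "((\<lambda>s. w j s - w k s) \<longlongrightarrow> w j t - w k t) (at t within {a..b})"
        by (intro tendsto_diff)
      then have "\<forall>\<^sub>F s in at t within {a..b}. 0 < w j s - w k s"
        using j by (auto dest: order_tendstoD(1)[of _ _ _ 0])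
      then obtain d where "d > 0" and d: "\<forall>s\<in>{a..b}. s \<noteq> t \<and> dist s t < d \<longrightarrow> 0 < w j s - w k s"
        unfolding eventually_at by blast
      have "w k v < \<phi> v" if "u \<in> {a..t}" "v \<in> {t..b}" "v - u < d" for u v
      proof -
        have "w k v < w j v"
          using d[rule_format, of v] that t j by (cases "v = t") (auto simp: dist_real_def)
        with w_le[of j v] show ?thesis by linarith
      qed
      with \<open>d > 0\<close> show ?thesis by (metis less_irrefl)
    qed
    then obtain d where d: "\<And>k. d k > 0"
      "\<And>k u v. u \<in> {a..t} \<Longrightarrow> v \<in> {t..b} \<Longrightarrow> v - u < d k \<Longrightarrow> w k v = \<phi> v \<Longrightarrow> w k v - w k u \<le> e * (v - u)"
      by metis
    show "\<exists>d>0. \<forall>u\<in>{a..t}. \<forall>v\<in>{t..b}. v - u < d \<longrightarrow> \<phi> v - \<phi> u \<le> e * (v - u)"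
    proof (intro exI[of _ "Min (range d)"] conjI ballI impI)
      show "Min (range d) > 0" using d(1) by auto
      fix u v assume uv: "u \<in> {a..t}" "v \<in> {t..b}" "v - u < Min (range d)"
      \<comment> \<open>Taking the index that attains the maximum at the right end \<open>v\<close>
        gives \<open>\<phi> v - \<phi> u \<le> w k v - w k u\<close>.\<close>
      obtain k where k: "\<phi> v = w k v" using \<phi>_eq by blast
      have "w k v - w k u \<le> e * (v - u)"
        using uv k by (intro d(2)) auto
      with k w_le[of k u] show "\<phi> v - \<phi> u \<le> e * (v - u)" by linarith
    qed
  qed
  with w_le[of k b] \<phi>_eq[of a] init show ?thesis by (metis order_trans)
qed

section \<open>First exits and families of disjoint intervals\<close>

text \<open>At the first time \<open>t\<close> with \<open>\<phi> t \<ge> \<epsilon>\<close> the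
  bound \<open>\<phi> \<le> \<epsilon>\<close> holds on all of \<open>{s..t}\<close>, by the
  intermediate value theorem also at \<open>t\<close> itself, so \<open>step\<close> gives the
  contradictory strict inequality.\<close>

lemma first_exit:
  fixes \<phi> :: "real \<Rightarrow> real"
  assumes "s \<le> T" and cont: "continuous_on {s..T} \<phi>"
    and step: "\<And>t. t \<in> {s..T} \<Longrightarrow> (\<And>r. r \<in> {s..t} \<Longrightarrow> \<phi> r \<le> \<epsilon>) \<Longrightarrow> \<phi> t < \<epsilon>"
    and init: "\<phi> s < \<epsilon>"
  shows "\<phi> T < \<epsilon>"
proof (rule ccontr)
  assume "\<not> \<phi> T < \<epsilon>"
  define A where "A = {s..T} \<inter> \<phi> -` {\<epsilon>..}"
  have "closed A"
    unfolding A_def by (rule continuous_closed_preimage[OF cont closed_atLeastAtMost closed_atLeast])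
  moreover have "bounded A"
    unfolding A_def by (rule bounded_subset[OF bounded_closed_interval]) auto
  ultimately have "compact A" by (simp add: compact_eq_bounded_closed)
  moreover have "T \<in> A" using \<open>\<not> \<phi> T < \<epsilon>\<close> \<open>s \<le> T\<close> by (simp add: A_def)
  ultimately obtain t where t: "t \<in> A" "\<And>r. r \<in> A \<Longrightarrow> t \<le> r"
    using compact_attains_inf[of A] by blast
  have "\<phi> r \<le> \<epsilon>" if r: "r \<in> {s..t}" for r
  proof (rule ccontr)
    assume "\<not> \<phi> r \<le> \<epsilon>"
    moreover have "continuous_on {s..r} \<phi>"
      using cont r t(1) by (auto simp: A_def intro: continuous_on_subset)
    ultimately obtain r' where "s \<le> r'" "r' \<le> r" "\<phi> r' = \<epsilon>"
      using IVT'[of \<phi> s \<epsilon> r] init r by auto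
    moreover from this have "r' \<in> A" using r t(1) by (simp add: A_def)
    ultimately have "r' = r" using t(2)[of r'] r by auto
    with \<open>\<phi> r' = \<epsilon>\<close> \<open>\<not> \<phi> r \<le> \<epsilon>\<close> show False by simp
  qed
  then have "\<phi> t < \<epsilon>" using t(1) by (intro step) (auto simp: A_def)
  with t(1) show False by (simp add: A_def)
qed

lemma infnorm_le_cart:
  fixes x :: "real ^ 'n::finite"
  assumes "\<And>i. \<bar>x $ i\<bar> \<le> B"
  shows "infnorm x \<le> B"
  unfolding infnorm_cart using assms by (intro cSup_least) auto

text \<open>Half the length is given up because an open interval of length \<open>\<tau>\<close>
  contains no closed one of that length. Without a closed piece of length \<open>\<tau> / 2\<close>,
  all points of \<open>J\<close> would lie within \<open>\<tau> / 2\<close> of its infimum.\<close>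

lemma long_interval_contains:
  assumes "is_interval J" "J \<subseteq> {0..}" "ennreal \<tau> \<le> emeasure lborel J" "\<tau> > 0"
  shows "\<exists>a. {a..a + \<tau> / 2} \<subseteq> J"
proof (rule ccontr)
  assume no: "\<not> ?thesis"
  have "emeasure lborel J \<noteq> 0"
    using assms(3,4) by auto
  then have "J \<noteq> {}" by auto
  have le: "z - \<tau> / 2 \<le> x" if "x \<in> J" "z \<in> J" for x z
  proof (rule ccontr)
    assume "\<not> ?thesis"
    then have "{x..x + \<tau> / 2} \<subseteq> {x..z}" by auto
    also have "\<dots> \<subseteq> J"
      using mem_is_interval_1_I[OF assms(1) that] by auto
    finally show False using no by blast
  qed
  have "J \<subseteq> {Inf J..Inf J + \<tau> / 2}"
  proof
    fix z assume "z \<in> J"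
    have "bdd_below J" using assms(2) by (meson bdd_below_Ici bdd_below_mono)
    then have "Inf J \<le> z" using \<open>z \<in> J\<close> by (intro cInf_lower)
    moreover have "z - \<tau> / 2 \<le> Inf J"
      using le \<open>z \<in> J\<close> \<open>J \<noteq> {}\<close> by (intro cInf_greatest)
    ultimately show "z \<in> {Inf J..Inf J + \<tau> / 2}" by simp
  qed
  then have "emeasure lborel J \<le> emeasure lborel {Inf J..Inf J + \<tau> / 2}"
    by (intro emeasure_mono) auto
  also have "\<dots> = ennreal (\<tau> / 2)" using \<open>\<tau> > 0\<close> by simp
  finally have "ennreal \<tau> \<le> ennreal (\<tau> / 2)" by (rule order_trans[OF assms(3)])
  with \<open>\<tau> > 0\<close> show False by (simp add: ennreal_le_iff)
qed

text \<open>Supplies arbitrarily late closed time slots of a fixed length. By the pigeonhole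
  principle only finitely many disjoint members can have their slot begin before
  \<open>T\<close>.\<close>

lemma disjoint_intervals_escape:
  fixes \<tau> T :: real
  assumes "infinite \<J>" "disjoint \<J>" "\<tau> > 0"
    and \<J>: "\<And>J. J \<in> \<J> \<Longrightarrow> is_interval J \<and> J \<subseteq> {0..} \<and> ennreal \<tau> \<le> emeasure lborel J"
  shows "\<exists>a\<ge>T. \<exists>J\<in>\<J>. {a..a + \<tau> / 2} \<subseteq> J"
proof (rule ccontr)
  assume no: "\<not> ?thesis"
  have "\<exists>a. {a..a + \<tau> / 2} \<subseteq> J" if "J \<in> \<J>" for J
    using long_interval_contains[of J \<tau>] \<J>[OF that] \<open>\<tau> > 0\<close> by blast
  then obtain a where a: "\<And>J. J \<in> \<J> \<Longrightarrow> {a J..a J + \<tau> / 2} \<subseteq> J" by metis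
  have a_less: "a J < T" if "J \<in> \<J>" for J
  proof (rule ccontr)
    assume "\<not> ?thesis"
    then have "T \<le> a J" by simp
    with no a[OF that] that show False by blast
  qed
  txt \<open>Disjoint members contain distinct multiples of $\tau / 2$.\<close>
  define k where "k J = \<lceil>a J / (\<tau> / 2)\<rceil>" for J
  have k: "k J * (\<tau> / 2) \<in> J" if "J \<in> \<J>" for J
  proof -
    have "a J / (\<tau> / 2) \<le> k J" "k J \<le> a J / (\<tau> / 2) + 1"
      unfolding k_def by linarith+
    then have "k J * (\<tau> / 2) \<in> {a J..a J + \<tau> / 2}"
      using \<open>\<tau> > 0\<close> by (simp add: field_simps)
    with a[OF that] show ?thesis by blast
  qed
  have "inj_on k \<J>"
  proof (rule inj_onI)
    fix J J' assume "J \<in> \<J>" "J' \<in> \<J>" "k J = k J'"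
    then have "J \<inter> J' \<noteq> {}" using k[of J] k[of J'] by auto
    with \<open>disjoint \<J>\<close> \<open>J \<in> \<J>\<close> \<open>J' \<in> \<J>\<close> show "J = J'" by (meson disjointD)
  qed
  moreover have "k ` \<J> \<subseteq> {0..\<lceil>T / (\<tau> / 2)\<rceil>}"
  proof clarify
    fix J assume J: "J \<in> \<J>"
    have "k J \<le> \<lceil>T / (\<tau> / 2)\<rceil>"
      unfolding k_def using a_less[OF J] \<open>\<tau> > 0\<close> by (intro ceiling_mono divide_right_mono) auto
    moreover have "0 \<le> k J * (\<tau> / 2)" using k[OF J] \<J>[OF J] by auto
    then have "0 \<le> k J" using \<open>\<tau> > 0\<close> by (simp add: zero_le_mult_iff)
    ultimately show "k J \<in> {0..\<lceil>T / (\<tau> / 2)\<rceil>}" by simp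
  qed
  ultimately have "finite \<J>"
    using finite_imageD finite_subset by blast
  with \<open>infinite \<J>\<close> show False by contradiction
qed

section \<open>Strongly convex functions\<close>

lemma strongly_convex_imp_convex_on_UNIV:
  assumes "locally_strongly_convex g"
  shows "convex_on UNIV g"
proof (rule convex_onI)
  fix t x z :: real assume t: "0 < t" "t < 1"
  obtain \<mu> where \<mu>: "\<mu> > 0" "strongly_convex_on {min x z..max x z} \<mu> g"
    using assms unfolding locally_strongly_convex_def by (metis bounded_closed_interval is_interval_cc)
  have "g ((1 - t) * x + (1 - (1 - t)) * z) \<le> (1 - t) * g x + (1 - (1 - t)) * g z
      - \<mu> / 2 * (1 - t) * (1 - (1 - t)) * (x - z)\<^sup>2"
    by (rule \<mu>(2)[unfolded strongly_convex_on_def, THEN conjunct2, rule_format]) (use t in auto)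
  moreover have "\<mu> / 2 * (1 - t) * (1 - (1 - t)) * (x - z)\<^sup>2 \<ge> 0"
    using \<mu> t by simp
  ultimately show "g ((1 - t) *\<^sub>R x + t *\<^sub>R z) \<le> (1 - t) * g x + t * g z"
    by simp
qed simp

text \<open>The midpoint of \<open>z\<close> and \<open>s\<close> has value at least
  \<open>g z\<close>, while strong convexity puts it strictly below the average of
  \<open>g z\<close> and \<open>g s\<close>.\<close>

lemma strongly_convex_gap:
  assumes "locally_strongly_convex g" "\<And>w. g z \<le> g w" "s \<noteq> z"
  shows "g z < g s"
proof -
  obtain \<mu> where \<mu>: "\<mu> > 0" "strongly_convex_on {min z s..max z s} \<mu> g"
    using assms(1) unfolding locally_strongly_convex_def by (metis bounded_closed_interval is_interval_cc)
  have "g (1/2 * z + (1 - 1/2) * s) \<le> 1/2 * g z + (1 - 1/2) * g s - \<mu> / 2 * (1/2) * (1 - 1/2) * (z - s)\<^sup>2"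
    by (rule \<mu>(2)[unfolded strongly_convex_on_def, THEN conjunct2, rule_format]) auto
  moreover have "\<mu> / 2 * (1/2) * (1 - 1/2) * (z - s)\<^sup>2 > 0"
    using \<mu> assms(3) by simp
  ultimately show ?thesis using assms(2)[of "1/2 * z + (1 - 1/2) * s"] by simp
qed

text \<open>The positive gap \<open>m\<close> at distance 1 from the minimiser propagates outwards
  by convexity to linear growth.\<close>

lemma strongly_convex_coercive:
  assumes "locally_strongly_convex g" "admits_minimum g"
  shows "\<exists>B. \<forall>z. g z \<le> C \<longrightarrow> \<bar>z\<bar> \<le> B"
proof -
  obtain z0 where z0: "\<And>w. g z0 \<le> g w"
    using assms(2) unfolding admits_minimum_def by blast
  define m where "m = min (g (z0 + 1)) (g (z0 - 1)) - g z0"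
  have "m > 0"
    using strongly_convex_gap[OF assms(1) z0] by (simp add: m_def)
  have growth: "m * \<bar>z - z0\<bar> \<le> g z - g z0" if "\<bar>z - z0\<bar> \<ge> 1" for z
  proof -
    define r where "r = \<bar>z - z0\<bar>"
    have r: "r \<ge> 1" using that r_def by simp
    \<comment> \<open>The weight \<open>1/r\<close> places the convex combination at distance
      exactly 1 from \<open>z0\<close> towards \<open>z\<close>.\<close>
    have "g ((1 - 1/r) *\<^sub>R z0 + (1/r) *\<^sub>R z) \<le> (1 - 1/r) * g z0 + (1/r) * g z"
      using r by (intro convex_onD[OF strongly_convex_imp_convex_on_UNIV[OF assms(1)]]) auto
    moreover have "(1 - 1/r) *\<^sub>R z0 + (1/r) *\<^sub>R z = (if z \<ge> z0 then z0 + 1 else z0 - 1)"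
      using r by (auto simp: r_def field_simps)
    ultimately have "g z0 + m \<le> (1 - 1/r) * g z0 + (1/r) * g z"
      by (auto simp: m_def split: if_splits)
    with r show ?thesis unfolding r_def[symmetric] by (simp add: field_simps)
  qed
  show ?thesis
  proof (intro exI[of _ "\<bar>z0\<bar> + 1 + \<bar>C - g z0\<bar> / m"] allI impI)
    fix z assume z: "g z \<le> C"
    show "\<bar>z\<bar> \<le> \<bar>z0\<bar> + 1 + \<bar>C - g z0\<bar> / m"
    proof (cases "\<bar>z - z0\<bar> \<ge> 1")
      case True
      have "\<bar>z - z0\<bar> \<le> \<bar>C - g z0\<bar> / m"
        using growth[OF True] z \<open>m > 0\<close> by (simp add: field_simps)
      then show ?thesis by linarith
    next
      case False
      moreover have "0 \<le> \<bar>C - g z0\<bar> / m" using \<open>m > 0\<close> by simp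
      ultimately show ?thesis by linarith
    qed
  qed
qed

section \<open>The interaction potential\<close>

text \<open>Each edge occurs in both orientations, with equal values under the symmetry
  \<open>f_sym\<close>; the factor 1/2 counts it once.\<close>

definition potential :: "('n \<Rightarrow> 'n \<Rightarrow> bool) \<Rightarrow> ('n \<Rightarrow> 'n \<Rightarrow> real \<Rightarrow> real) \<Rightarrow> real ^ 'n::finite \<Rightarrow> real" where
  "potential nbr f x = (\<Sum>i\<in>UNIV. \<Sum>j | nbr i j. f i j (x $ j - x $ i)) / 2"

text \<open>The partial derivative of \<open>potential\<close> in coordinate \<open>i\<close>, given
  by its formula; \<open>potential_has_derivative\<close> justifies this reading.\<close>

definition gradient ::
  "('n \<Rightarrow> 'n \<Rightarrow> bool) \<Rightarrow> ('n \<Rightarrow> 'n \<Rightarrow> real \<Rightarrow> real) \<Rightarrow> 'n \<Rightarrow> real ^ 'n::finite \<Rightarrow> real" where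
  "gradient nbr f i x = - (\<Sum>j | nbr i j. deriv (f i j) (x $ j - x $ i))"

locale interaction =
  fixes nbr :: "'n::finite \<Rightarrow> 'n \<Rightarrow> bool" and f :: "'n \<Rightarrow> 'n \<Rightarrow> real \<Rightarrow> real"
  assumes graph: "connected_simple_graph nbr"
    and f_diff: "nbr i j \<Longrightarrow> f i j differentiable_on UNIV"
    and f_diff2: "nbr i j \<Longrightarrow> deriv (f i j) differentiable_on UNIV"
    and f_sym: "nbr i j \<Longrightarrow> f i j z = f j i (- z)"
    and f_convex: "nbr i j \<Longrightarrow> locally_strongly_convex (f i j)"
    and f_min: "nbr i j \<Longrightarrow> admits_minimum (f i j)"
    and f_nonneg: "nbr i j \<Longrightarrow> 0 \<le> f i j z"
begin

abbreviation "V \<equiv> potential nbr f"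
abbreviation "G \<equiv> gradient nbr f"

section \<open>Pair forces and the gradient: symmetry, monotonicity, derivative along curves\<close>

lemma nbr_sym: "nbr i j \<Longrightarrow> nbr j i"
  using graph by (auto simp: connected_simple_graph_def)

lemma f_deriv: "nbr i j \<Longrightarrow> (f i j has_real_derivative deriv (f i j) z) (at z)"
  using f_diff[of i j] by (simp add: differentiable_on_def DERIV_deriv_iff_real_differentiable)

lemma f_deriv_chain:
  assumes "nbr i j" "(w has_real_derivative w') (at t within S)"
  shows "((\<lambda>s. f i j (w s)) has_real_derivative deriv (f i j) (w t) * w') (at t within S)"
  using DERIV_chain2[OF f_deriv[OF assms(1)] assms(2)] .

lemma f'_cont: "nbr i j \<Longrightarrow> continuous_on UNIV (deriv (f i j))"
  using f_diff2 by (rule differentiable_imp_continuous_on)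

lemma f_cont: "nbr i j \<Longrightarrow> continuous_on UNIV (f i j)"
  using f_diff by (rule differentiable_imp_continuous_on)

lemma f'_antisym:
  assumes "nbr i j"
  shows "deriv (f i j) z = - deriv (f j i) (- z)"
proof -
  have "((\<lambda>z. f j i (- z)) has_real_derivative deriv (f j i) (- z) * - 1) (at z)"
    by (rule f_deriv_chain[OF nbr_sym[OF assms]]) (auto intro!: derivative_eq_intros)
  moreover have "(\<lambda>z. f j i (- z)) = f i j"
    using f_sym[OF assms] by auto
  ultimately show ?thesis
    using f_deriv[OF assms, of z] DERIV_unique by fastforce
qed

lemma f'_mono:
  assumes "nbr i j" "z \<le> w"
  shows "deriv (f i j) z \<le> deriv (f i j) w"
proof -
  note convex = strongly_convex_imp_convex_on_UNIV[OF f_convex[OF assms(1)]]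
  \<comment> \<open>The tangents at \<open>z\<close> and at \<open>w\<close>: adding both
    inequalities cancels the values and leaves only the slopes.\<close>
  have "deriv (f i j) z * (w - z) \<le> f i j w - f i j z" "deriv (f i j) w * (z - w) \<le> f i j z - f i j w"
    by (rule convex_on_imp_above_tangent[OF convex]; simp add: f_deriv[OF assms(1)])+
  then have "(deriv (f i j) z - deriv (f i j) w) * (w - z) \<le> 0"
    by (simp add: algebra_simps)
  with assms(2) show ?thesis
    by (cases "z = w") (auto simp: mult_le_0_iff)
qed

text \<open>The hypothesis says \<open>x $ j - x $ i \<le> x0 $ j - x0 $ i\<close>, so every term of
  the sum can only decrease from \<open>x0\<close> to \<open>x\<close>, and the minus sign in
  \<open>gradient\<close> reverses this.\<close>

lemma gradient_mono:
  assumes "\<And>j. x $ j - x0 $ j \<le> x $ i - x0 $ i"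
  shows "G i x0 \<le> G i x"
  unfolding gradient_def using assms
  by (auto intro!: sum_mono f'_mono simp: algebra_simps)

lemma gradient_antimono:
  assumes "\<And>j. x $ i - x0 $ i \<le> x $ j - x0 $ j"
  shows "G i x \<le> G i x0"
  unfolding gradient_def using assms
  by (auto intro!: sum_mono f'_mono simp: algebra_simps)

lemma continuous_gradient: "continuous_on UNIV (G i)"
  unfolding gradient_def
  by (intro continuous_intros continuous_on_compose2[OF f'_cont]) auto

lemma continuous_potential: "continuous_on UNIV V"
  unfolding potential_def
  by (intro continuous_intros continuous_on_compose2[OF f_cont]) auto

text \<open>The chain rule yields a factor \<open>d j - d i\<close> on each ordered pair. Exchanging
  the roles of \<open>i\<close> and \<open>j\<close>, with the antisymmetry of the derivatives,
  turns the \<open>d j\<close> half into a copy of the \<open>d i\<close> half, which cancels the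
  factor 1/2.\<close>

lemma potential_has_derivative:
  assumes x: "\<And>i. ((\<lambda>s. x s $ i) has_real_derivative d i) (at t within S)"
  shows "((\<lambda>s. V (x s)) has_real_derivative (\<Sum>i\<in>UNIV. G i (x t) * d i)) (at t within S)"
proof -
  let ?D = "\<lambda>i j. deriv (f i j) (x t $ j - x t $ i)"
  have swap: "(\<Sum>i\<in>UNIV. \<Sum>j | nbr i j. g i j) = (\<Sum>i\<in>UNIV. \<Sum>j | nbr i j. g j i)"
    for g :: "'n \<Rightarrow> 'n \<Rightarrow> real"
  proof -
    have "{i. nbr i j} = {i. nbr j i}" for j using nbr_sym by blast
    then show ?thesis using sum.swap_restrict[of UNIV UNIV g nbr] by simp
  qed
  have D: "?D j i = - ?D i j" if "nbr i j" for i j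
    using f'_antisym[OF that, of "x t $ j - x t $ i"] by simp
  have "(\<Sum>i\<in>UNIV. \<Sum>j | nbr i j. ?D i j * (d j - d i)) =
      (\<Sum>i\<in>UNIV. \<Sum>j | nbr i j. ?D i j * d j) - (\<Sum>i\<in>UNIV. \<Sum>j | nbr i j. ?D i j * d i)"
    by (simp add: algebra_simps sum_subtractf)
  also have "(\<Sum>i\<in>UNIV. \<Sum>j | nbr i j. ?D i j * d j) = (\<Sum>i\<in>UNIV. \<Sum>j | nbr i j. ?D j i * d i)"
    by (rule swap)
  also have "\<dots> = - (\<Sum>i\<in>UNIV. \<Sum>j | nbr i j. ?D i j * d i)"
    by (simp add: D sum_negf)
  finally have eq: "(\<Sum>i\<in>UNIV. \<Sum>j | nbr i j. ?D i j * (d j - d i)) / 2 = (\<Sum>i\<in>UNIV. G i (x t) * d i)"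
    by (simp add: gradient_def sum_distrib_right sum_negf)
  have "((\<lambda>s. V (x s)) has_real_derivative (\<Sum>i\<in>UNIV. \<Sum>j | nbr i j. ?D i j * (d j - d i)) / 2) (at t within S)"
    unfolding potential_def
    by (intro DERIV_cdivide DERIV_sum f_deriv_chain DERIV_diff x) auto
  then show ?thesis by (simp only: eq)
qed

section \<open>Coercivity and minimisers of the potential\<close>

lemma edge_le_potential:
  assumes "nbr i j"
  shows "f i j (x $ j - x $ i) \<le> 2 * V x"
proof -
  have "f i j (x $ j - x $ i) \<le> (\<Sum>j | nbr i j. f i j (x $ j - x $ i))"
    using assms f_nonneg by (intro member_le_sum[of j _ "\<lambda>j. f i j (x $ j - x $ i)"]) auto
  also have "\<dots> \<le> (\<Sum>i\<in>UNIV. \<Sum>j | nbr i j. f i j (x $ j - x $ i))"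
    using f_nonneg by (intro member_le_sum[of i _ "\<lambda>i. \<Sum>j | nbr i j. f i j (x $ j - x $ i)"]) (auto intro: sum_nonneg)
  finally show ?thesis by (simp add: potential_def)
qed

text \<open>Bounds on single edges add up along a path from \<open>k\<close>. Only differences can
  be bounded, as \<open>V\<close> is invariant under common translations.\<close>

lemma sublevel_bounded:
  "\<exists>B. \<forall>x. V x \<le> C \<longrightarrow> (\<forall>i. \<bar>x $ i - x $ k\<bar> \<le> B)"
proof -
  have "\<exists>B. \<forall>x. V x \<le> C \<longrightarrow> \<bar>x $ i - x $ k\<bar> \<le> B" for i
  proof -
    have "nbr\<^sup>*\<^sup>* k i" using graph by (simp add: connected_simple_graph_def)
    then show ?thesis
    proof induction
      case base
      then show ?case by (intro exI[of _ 0]) simp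
    next
      case (step i j)
      then obtain B where B: "\<And>x. V x \<le> C \<Longrightarrow> \<bar>x $ i - x $ k\<bar> \<le> B" by blast
      obtain B' where B': "\<And>z. f i j z \<le> 2 * C \<Longrightarrow> \<bar>z\<bar> \<le> B'"
        using strongly_convex_coercive[OF f_convex f_min] step(2) by blast
      have "\<bar>x $ j - x $ k\<bar> \<le> B + B'" if "V x \<le> C" for x
        using B[OF that] B'[of "x $ j - x $ i"] edge_le_potential[OF step(2), of x] that by fastforce
      then show ?case by blast
    qed
  qed
  then obtain B where B: "\<And>i x. V x \<le> C \<Longrightarrow> \<bar>x $ i - x $ k\<bar> \<le> B i" by metis
  have "\<bar>x $ i - x $ k\<bar> \<le> Max (range B)" if "V x \<le> C" for x i
    using B[OF that, of i] by (rule order_trans) simp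
  then show ?thesis by blast
qed

lemma potential_minimizer:
  obtains x0 where "\<And>x. V x0 \<le> V x"
proof -
  fix k :: 'n
  \<comment> \<open>Fixing coordinate \<open>k\<close> to 0 removes the translation invariance of
    \<open>V\<close> and makes the sublevel set compact.\<close>
  define K where "K = {x. V x \<le> V 0 \<and> x $ k = 0}"
  obtain B where B: "\<And>x i. V x \<le> V 0 \<Longrightarrow> \<bar>x $ i - x $ k\<bar> \<le> B"
    using sublevel_bounded by blast
  have "bounded K"
    by (rule boundedI[of _ "real CARD('n) * B"])
      (use B in \<open>force simp: K_def intro!: order_trans[OF norm_le_l1_cart] sum_bounded_above\<close>)
  moreover have "closed K"
    unfolding K_def by (intro closed_Collect_conj closed_Collect_le closed_Collect_eq continuous_potential continuous_intros)
  ultimately have "compact K" using compact_eq_bounded_closed by blast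
  moreover have "0 \<in> K" by (simp add: K_def)
  ultimately obtain x0 where x0: "x0 \<in> K" "\<And>x. x \<in> K \<Longrightarrow> V x0 \<le> V x"
    using continuous_attains_inf[of K V] continuous_on_subset[OF continuous_potential] by blast
  have "V x0 \<le> V x" for x
  proof (cases "V x \<le> V 0")
    case True
    have "V (\<chi> i. x $ i - x $ k) = V x" by (simp add: potential_def)
    with True x0(2)[of "\<chi> i. x $ i - x $ k"] show ?thesis by (simp add: K_def)
  next
    case False
    with x0(1) show ?thesis by (simp add: K_def)
  qed
  then show ?thesis using that by blast
qed

text \<open>A minimiser of \<open>V\<close> is stationary along each coordinate line.\<close>

lemma equilibrium_exists:
  obtains x0 where "\<And>i. G i x0 = 0"
proof -
  obtain x0 where x0: "\<And>x. V x0 \<le> V x" using potential_minimizer by blast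
  have "G i x0 = 0" for i
  proof -
    define x where "x s = (\<chi> j. x0 $ j + (if j = i then s else 0))" for s
    have x_0: "x 0 = x0" by (simp add: x_def vec_eq_iff)
    have "((\<lambda>s. x s $ j) has_real_derivative (if j = i then 1 else 0)) (at 0)" for j
      by (auto simp: x_def intro!: derivative_eq_intros)
    then have "((\<lambda>s. V (x s)) has_real_derivative (\<Sum>j\<in>UNIV. G j (x 0) * (if j = i then 1 else 0))) (at 0)"
      by (rule potential_has_derivative)
    then have "((\<lambda>s. V (x s)) has_real_derivative G i x0) (at 0)"
      by (simp add: x_0 if_distrib[of "(*) _"] cong: if_cong)
    then show ?thesis
      by (rule DERIV_local_min[of _ _ _ 1]) (auto simp: x_0 x0)
  qed
  then show ?thesis using that by blast
qed

section \<open>Lipschitz bounds on bounded sets\<close>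

lemma f_lipschitz:
  assumes "nbr i j"
  obtains M where "M \<ge> 0" "\<And>z w. \<bar>z\<bar> \<le> R \<Longrightarrow> \<bar>w\<bar> \<le> R \<Longrightarrow> \<bar>f i j z - f i j w\<bar> \<le> M * \<bar>z - w\<bar>"
proof
  \<comment> \<open>The derivative is monotone, so its two end values bound it on the whole interval
    from \<open>- R\<close> to \<open>R\<close>.\<close>
  define M where "M = max \<bar>deriv (f i j) (- R)\<bar> \<bar>deriv (f i j) R\<bar>"
  show "M \<ge> 0" by (simp add: M_def)
  fix z w :: real assume "\<bar>z\<bar> \<le> R" "\<bar>w\<bar> \<le> R"
  moreover have "\<bar>deriv (f i j) s\<bar> \<le> M" if "s \<in> {-R..R}" for s
    using f'_mono[OF assms, of "-R" s] f'_mono[OF assms, of s R] that by (auto simp: M_def)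
  ultimately have "norm (f i j z - f i j w) \<le> M * norm (z - w)"
    by (intro field_differentiable_bound[of "{-R..R}"])
      (auto intro: has_field_derivative_at_within f_deriv[OF assms])
  then show "\<bar>f i j z - f i j w\<bar> \<le> M * \<bar>z - w\<bar>" by simp
qed

lemma potential_lipschitz:
  obtains L where "L \<ge> 0"
    "\<And>x x'. (\<And>i. \<bar>x $ i\<bar> \<le> R) \<Longrightarrow> (\<And>i. \<bar>x' $ i\<bar> \<le> R) \<Longrightarrow> \<bar>V x - V x'\<bar> \<le> L * norm (x - x')"
proof -
  \<comment> \<open>Differences of two coordinates bounded by \<open>R\<close> are bounded by
    \<open>2 * R\<close>.\<close>
  have "\<exists>M\<ge>0. \<forall>z w. \<bar>z\<bar> \<le> 2 * R \<longrightarrow> \<bar>w\<bar> \<le> 2 * R \<longrightarrow> \<bar>f i j z - f i j w\<bar> \<le> M * \<bar>z - w\<bar>"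
    if "nbr i j" for i j
    using f_lipschitz[OF that] by metis
  then obtain M where M: "\<And>i j. nbr i j \<Longrightarrow> M i j \<ge> 0"
    "\<And>i j z w. nbr i j \<Longrightarrow> \<bar>z\<bar> \<le> 2 * R \<Longrightarrow> \<bar>w\<bar> \<le> 2 * R \<Longrightarrow> \<bar>f i j z - f i j w\<bar> \<le> M i j * \<bar>z - w\<bar>"
    by metis
  show ?thesis
  proof (rule that[of "\<Sum>i\<in>UNIV. \<Sum>j | nbr i j. M i j"])
    show "(\<Sum>i\<in>UNIV. \<Sum>j | nbr i j. M i j) \<ge> 0"
      using M(1) by (intro sum_nonneg) auto
    fix x x' :: "real ^ 'n" assume x: "\<And>i. \<bar>x $ i\<bar> \<le> R" "\<And>i. \<bar>x' $ i\<bar> \<le> R"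
    \<comment> \<open>Each coordinate difference moves by at most twice
      \<open>norm (x - x')\<close>; this 2 cancels the 1/2 in \<open>V\<close>.\<close>
    have edge: "\<bar>f i j (x $ j - x $ i) - f i j (x' $ j - x' $ i)\<bar> \<le> M i j * (2 * norm (x - x'))" if "nbr i j" for i j
    proof -
      have "\<bar>f i j (x $ j - x $ i) - f i j (x' $ j - x' $ i)\<bar> \<le> M i j * \<bar>(x $ j - x $ i) - (x' $ j - x' $ i)\<bar>"
        using x(1)[of i] x(1)[of j] x(2)[of i] x(2)[of j] by (intro M(2)[OF that]) linarith+
      also have "\<bar>(x $ j - x $ i) - (x' $ j - x' $ i)\<bar> \<le> 2 * norm (x - x')"
        using component_le_norm_cart[of "x - x'" i] component_le_norm_cart[of "x - x'" j] by simp
      finally show ?thesis using M(1)[OF that] by (simp add: mult_left_mono)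
    qed
    have "\<bar>2 * V x - 2 * V x'\<bar> \<le> (\<Sum>i\<in>UNIV. \<Sum>j | nbr i j. M i j * (2 * norm (x - x')))"
      unfolding potential_def
      by (simp add: sum_subtractf[symmetric])
        (intro order_trans[OF sum_abs] sum_mono order_trans[OF sum_abs], simp add: edge)
    also have "\<dots> = 2 * ((\<Sum>i\<in>UNIV. \<Sum>j | nbr i j. M i j) * norm (x - x'))"
      by (simp add: sum_distrib_right sum_distrib_left mult_ac)
    finally show "\<bar>V x - V x'\<bar> \<le> (\<Sum>i\<in>UNIV. \<Sum>j | nbr i j. M i j) * norm (x - x')"
      by linarith
  qed
qed

end

section \<open>Trajectories\<close>

locale perturbed_system = interaction nbr f
  for nbr :: "'n::finite \<Rightarrow> 'n \<Rightarrow> bool" and f :: "'n \<Rightarrow> 'n \<Rightarrow> real \<Rightarrow> real" +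
  fixes pbar :: "'n \<Rightarrow> 'n \<Rightarrow> real"
    and h :: "'n \<Rightarrow> real \<Rightarrow> real \<Rightarrow> real"
    and p :: "'n \<Rightarrow> 'n \<Rightarrow> real \<Rightarrow> real"
    and y :: "real \<Rightarrow> real ^ 'n"
  assumes pbar_nonneg: "nbr i j \<Longrightarrow> 0 \<le> pbar i j"
    and h_sign: "sign_preserving (h i)"
    and traj: "trajectory nbr f pbar h p y"
begin

abbreviation "u \<equiv> control nbr f pbar p y"

text \<open>The right-hand side of the dynamics at every time; by \<open>y_deriv\<close> it is the
  derivative of \<open>y\<close> outside a null set.\<close>

definition "velocity i t = h i t (u i t)"

section \<open>Brackets around the gradient and the sign of the control\<close>

lemma g_plus_eq:
  "g_plus nbr f pbar p y i t = - (\<Sum>j | nbr i j. deriv (f i j) (measurement p y i j t - pbar i j))"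
proof -
  \<comment> \<open>The derivative is monotone, so the supremum is attained at the left end
    \<open>- pbar i j\<close>, which belongs to the interval because \<open>pbar i j\<close> is
    nonnegative.\<close>
  have "(SUP q\<in>{- pbar i j .. pbar i j}. - deriv (f i j) (m + q)) = - deriv (f i j) (m - pbar i j)"
    if "nbr i j" for j m
    using pbar_nonneg[OF that]
    by (intro cSup_eq_maximum) (auto intro!: f'_mono[OF that] image_eqI[of _ _ "- pbar i j"])
  then show ?thesis by (simp add: g_plus_def sum_negf)
qed

lemma g_minus_eq:
  "g_minus nbr f pbar p y i t = - (\<Sum>j | nbr i j. deriv (f i j) (measurement p y i j t + pbar i j))"
proof -
  have "(INF q\<in>{- pbar i j .. pbar i j}. - deriv (f i j) (m + q)) = - deriv (f i j) (m + pbar i j)"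
    if "nbr i j" for j m
    using pbar_nonneg[OF that]
    by (intro cInf_eq_minimum) (auto intro!: f'_mono[OF that] image_eqI[of _ _ "pbar i j"])
  then show ?thesis by (simp add: g_minus_def sum_negf)
qed

lemma perturbation_le: "nbr i j \<Longrightarrow> 0 \<le> t \<Longrightarrow> \<bar>p i j t\<bar> \<le> pbar i j"
  using traj by (auto simp: trajectory_def)

text \<open>The measurement is off by at most \<open>pbar i j\<close>, and the supremum or infimum
  shifts the argument by \<open>pbar i j\<close> more. Hence the true gradient lies inside the
  bracket, and a total shift of \<open>2 * pbar i j\<close> encloses the bracket.\<close>

lemma
  assumes "0 \<le> t"
  shows gt_minus_le: "gt_minus nbr f pbar i (y t) \<le> g_minus nbr f pbar p y i t"
    and g_minus_le: "g_minus nbr f pbar p y i t \<le> G i (y t)"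
    and g_plus_ge: "G i (y t) \<le> g_plus nbr f pbar p y i t"
    and gt_plus_ge: "g_plus nbr f pbar p y i t \<le> gt_plus nbr f pbar i (y t)"
  unfolding gt_minus_def gt_plus_def g_minus_eq g_plus_eq gradient_def measurement_def neg_le_iff_le
  using perturbation_le[of i, OF _ assms]
  by (force intro!: sum_mono f'_mono simp: abs_le_iff)+

text \<open>As \<open>g_plus\<close> lies above the true gradient, it is nonnegative too, and the
  \<open>min\<close> term of the control vanishes.\<close>

lemma control_nonpos: "0 \<le> t \<Longrightarrow> 0 \<le> G i (y t) \<Longrightarrow> u i t \<le> 0"
  using g_plus_ge[of t i] by (simp add: control_def)

lemma control_nonneg: "0 \<le> t \<Longrightarrow> G i (y t) \<le> 0 \<Longrightarrow> 0 \<le> u i t"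
  using g_minus_le[of t i] by (simp add: control_def)

lemma velocity_nonpos: "0 \<le> t \<Longrightarrow> u i t \<le> 0 \<Longrightarrow> velocity i t \<le> 0"
  using h_sign[of i] unfolding sign_preserving_def velocity_def by (cases "u i t = 0") auto

lemma velocity_nonneg: "0 \<le> t \<Longrightarrow> 0 \<le> u i t \<Longrightarrow> 0 \<le> velocity i t"
  using h_sign[of i] unfolding sign_preserving_def velocity_def by (cases "u i t = 0") auto

lemma gradient_velocity:
  assumes "0 \<le> t"
  shows "G i (y t) * velocity i t = - (\<bar>G i (y t)\<bar> * \<bar>velocity i t\<bar>)"
proof (cases "0 \<le> G i (y t)")
  case True
  with velocity_nonpos[OF assms control_nonpos] assms show ?thesis by simp
next
  case False
  then have "0 \<le> velocity i t" using velocity_nonneg[OF assms control_nonneg] assms by simp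
  with False show ?thesis by simp
qed

text \<open>All summands are nonpositive by \<open>gradient_velocity\<close>, so the one for
  \<open>k\<close> alone is an upper bound. It is what pays for the motion of agent
  \<open>k\<close>.\<close>

lemma dissipation:
  assumes "0 \<le> t"
  shows "(\<Sum>i\<in>UNIV. G i (y t) * velocity i t) \<le> - (\<bar>G k (y t)\<bar> * \<bar>velocity k t\<bar>)"
proof -
  have "\<bar>G k (y t)\<bar> * \<bar>velocity k t\<bar> \<le> (\<Sum>i\<in>UNIV. \<bar>G i (y t)\<bar> * \<bar>velocity i t\<bar>)"
    by (rule member_le_sum) auto
  then show ?thesis by (simp add: gradient_velocity[OF assms] sum_negf)
qed

section \<open>Regularity of the trajectory, decrease of the potential, maximum principle\<close>

lemma y_ac: "0 \<le> s \<Longrightarrow> absolutely_continuous_on {s..T} y"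
  using traj absolutely_continuous_on_subset[of "{0..max 0 T}" y "{s..T}"]
  by (auto simp: trajectory_def)

lemma y_cont: "0 \<le> s \<Longrightarrow> continuous_on {s..T} y"
  by (intro absolutely_continuous_on_imp_continuous_on y_ac)

lemma y_deriv:
  obtains N where "N \<in> null_sets lborel"
    "\<And>i t s T. 0 \<le> s \<Longrightarrow> t \<in> {s..T} - N \<Longrightarrow>
      ((\<lambda>t. y t $ i) has_real_derivative velocity i t) (at t within {s..T})"
proof -
  have "AE t in lborel. 0 \<le> t \<longrightarrow>
      (\<forall>i. ((\<lambda>s. y s $ i) has_real_derivative velocity i t) (at t within {0..}))"
    using traj by (simp add: trajectory_def velocity_def)
  then obtain N where N: "N \<in> null_sets lborel" "{t \<in> space lborel. \<not> (0 \<le> t \<longrightarrow>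
      (\<forall>i. ((\<lambda>s. y s $ i) has_real_derivative velocity i t) (at t within {0..})))} \<subseteq> N"
    unfolding eventually_ae_filter by blast
  show ?thesis
  proof (rule that[OF N(1)])
    fix i and t s T :: real assume "0 \<le> s" "t \<in> {s..T} - N"
    then have "0 \<le> t" "t \<notin> N" by auto
    with N(2) have "((\<lambda>s. y s $ i) has_real_derivative velocity i t) (at t within {0..})"
      by (simp add: subset_eq) blast
    then show "((\<lambda>t. y t $ i) has_real_derivative velocity i t) (at t within {s..T})"
      using \<open>0 \<le> s\<close> by (elim DERIV_subset) auto
  qed
qed

lemma V_lipschitz_along:
  assumes "0 \<le> s"
  obtains L where "L \<ge> 0" "\<And>a b. a \<in> {s..T} \<Longrightarrow> b \<in> {s..T} \<Longrightarrow> \<bar>V (y b) - V (y a)\<bar> \<le> L * norm (y b - y a)"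
proof -
  have "bounded (y ` {s..T})"
    using compact_continuous_image[OF y_cont[OF assms]] compact_imp_bounded by blast
  then obtain R where R: "\<And>t. t \<in> {s..T} \<Longrightarrow> norm (y t) \<le> R"
    unfolding bounded_iff by (metis imageI)
  obtain L where "L \<ge> 0"
    "\<And>x x'. (\<And>i. \<bar>x $ i\<bar> \<le> R) \<Longrightarrow> (\<And>i. \<bar>x' $ i\<bar> \<le> R) \<Longrightarrow> \<bar>V x - V x'\<bar> \<le> L * norm (x - x')"
    using potential_lipschitz by blast
  then show ?thesis using R component_le_norm_cart that by (meson order_trans)
qed

lemma V_antimono:
  assumes "0 \<le> s" "s \<le> T"
  shows "V (y T) \<le> V (y s)"
proof -
  obtain N where N: "N \<in> null_sets lborel" and der: "\<And>i t. t \<in> {s..T} - N \<Longrightarrow>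
      ((\<lambda>t. y t $ i) has_real_derivative velocity i t) (at t within {s..T})"
    using y_deriv assms(1) by metis
  obtain L where L: "L \<ge> 0" "\<And>a b. a \<in> {s..T} \<Longrightarrow> b \<in> {s..T} \<Longrightarrow> \<bar>V (y b) - V (y a)\<bar> \<le> L * norm (y b - y a)"
    using V_lipschitz_along[OF assms(1)] by blast
  show ?thesis
  \<comment> \<open>A one-element index type reduces the maximum to the single function
    \<open>V (y t)\<close>.\<close>
  proof (rule absolutely_continuous_max_descent[of s T y "\<lambda>_::unit. \<lambda>t. V (y t)" L N
        "\<lambda>_ t. \<Sum>i\<in>UNIV. G i (y t) * velocity i t"])
    show "\<bar>V (y b) - V (y a)\<bar> \<le> L * (norm (y b - y a) + \<bar>b - a\<bar>)"
      if "a \<in> {s..T}" "b \<in> {s..T}" for a b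
      using L(2)[OF that] mult_nonneg_nonneg[OF L(1), of "\<bar>b - a\<bar>"] by (simp add: distrib_left)
    show "((\<lambda>t. V (y t)) has_real_derivative (\<Sum>i\<in>UNIV. G i (y t) * velocity i t)) (at t within {s..T})"
      if "t \<in> {s..T} - N" for t
      by (intro potential_has_derivative der that)
    show "(\<Sum>i\<in>UNIV. G i (y t) * velocity i t) \<le> 0" if "t \<in> {s..T} - N" for t
      \<comment> \<open>The bound from \<open>dissipation\<close> is nonpositive whichever agent is
        chosen, hence \<open>undefined\<close>.\<close>
      using dissipation[of t undefined] that assms(1) by (auto intro: order_trans)
  qed (use assms y_ac N in auto)
qed

text \<open>Applied with \<open>K = 0\<close> around an equilibrium for boundedness, and with a
  possibly large \<open>K\<close> around a limit point for convergence. The condition is asked of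
  every agent, as any of them may attain the maximum.\<close>

lemma max_principle:
  assumes "0 \<le> s" "s \<le> T" "0 \<le> K"
    and cond: "\<And>t i. t \<in> {s..T} \<Longrightarrow> 1 \<le> K * \<bar>G i (y t)\<bar> \<or> G i x0 = 0"
    and init: "\<And>i. \<bar>y s $ i - x0 $ i\<bar> \<le> B"
  shows "\<bar>y T $ i - x0 $ i\<bar> + K * V (y T) \<le> B + K * V (y s)"
proof -
  obtain N where N: "N \<in> null_sets lborel" and der: "\<And>i t. t \<in> {s..T} - N \<Longrightarrow>
      ((\<lambda>t. y t $ i) has_real_derivative velocity i t) (at t within {s..T})"
    using y_deriv assms(1) by metis
  obtain L where L: "L \<ge> 0" "\<And>a b. a \<in> {s..T} \<Longrightarrow> b \<in> {s..T} \<Longrightarrow> \<bar>V (y b) - V (y a)\<bar> \<le> L * norm (y b - y a)"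
    using V_lipschitz_along[OF assms(1)] by blast
  \<comment> \<open>Doubling the index by a sign writes \<open>\<bar>y t $ i - x0 $ i\<bar>\<close>
    as a maximum of two functions without absolute values.\<close>
  define \<sigma> where "\<sigma> b = (if b then 1 else - 1 :: real)" for b
  define w where "w = (\<lambda>(i, b) t. \<sigma> b * (y t $ i - x0 $ i) + K * V (y t))"
  define w' where "w' = (\<lambda>(i, b) t. \<sigma> b * velocity i t + K * (\<Sum>j\<in>UNIV. G j (y t) * velocity j t))"
  have "w k T \<le> B + K * V (y s)" for k
  proof (rule absolutely_continuous_max_descent[of s T y w "1 + K * L" N w'])
    fix k :: "'n \<times> bool" and a b assume ab: "a \<in> {s..T}" "b \<in> {s..T}"
    obtain i c where k: "k = (i, c)" by (cases k)
    have "w k b - w k a = \<sigma> c * (y b $ i - y a $ i) + K * (V (y b) - V (y a))"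
      by (simp add: w_def k algebra_simps)
    then have "\<bar>w k b - w k a\<bar> \<le> \<bar>y b $ i - y a $ i\<bar> + K * \<bar>V (y b) - V (y a)\<bar>"
      using \<open>0 \<le> K\<close> abs_triangle_ineq[of "\<sigma> c * (y b $ i - y a $ i)" "K * (V (y b) - V (y a))"]
      by (simp add: abs_mult \<sigma>_def split: if_splits)
    also have "\<dots> \<le> norm (y b - y a) + K * (L * norm (y b - y a))"
      using component_le_norm_cart[of "y b - y a" i] L(2)[OF ab] \<open>0 \<le> K\<close>
      by (intro add_mono mult_left_mono) auto
    also have "\<dots> = (1 + K * L) * norm (y b - y a)" by (simp add: algebra_simps)
    also have "\<dots> \<le> (1 + K * L) * (norm (y b - y a) + \<bar>b - a\<bar>)"
      using \<open>0 \<le> K\<close> L(1) by (intro mult_left_mono) auto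
    finally show "\<bar>w k b - w k a\<bar> \<le> (1 + K * L) * (norm (y b - y a) + \<bar>b - a\<bar>)" .
  next
    fix t and k :: "'n \<times> bool" assume t: "t \<in> {s..T} - N"
    then have "0 \<le> t" using assms(1) by simp
    obtain i c where k: "k = (i, c)" by (cases k)
    show "(w k has_real_derivative w' k t) (at t within {s..T})"
      unfolding w_def w'_def k prod.case
      using DERIV_add[OF DERIV_cmult[OF DERIV_diff[OF der[OF t, of i] DERIV_const]] DERIV_cmult[OF potential_has_derivative[OF der[OF t]]]]
      by simp
    assume max: "\<And>j. w j t \<le> w k t"
    let ?P = "\<Sum>j\<in>UNIV. G j (y t) * velocity j t"
    from cond[of t i] t consider "1 \<le> K * \<bar>G i (y t)\<bar>" | "G i x0 = 0" by auto
    then have "\<sigma> c * velocity i t + K * ?P \<le> 0"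
    proof cases
      case 1
      \<comment> \<open>The decrease of \<open>K * V\<close> outweighs the speed of agent
        \<open>i\<close>, whether or not \<open>(i, c)\<close> is maximal.\<close>
      have "K * ?P \<le> K * - (\<bar>G i (y t)\<bar> * \<bar>velocity i t\<bar>)"
        by (intro mult_left_mono dissipation \<open>0 \<le> t\<close> \<open>0 \<le> K\<close>)
      also have "\<dots> = - ((K * \<bar>G i (y t)\<bar>) * \<bar>velocity i t\<bar>)" by simp
      also have "\<dots> \<le> - (1 * \<bar>velocity i t\<bar>)"
        using 1 by (intro le_imp_neg_le mult_right_mono) auto
      also have "\<dots> \<le> - (\<sigma> c * velocity i t)" by (auto simp: \<sigma>_def)
      finally show ?thesis by simp
    next
      case 2
      have "K * ?P \<le> 0"
        using dissipation[OF \<open>0 \<le> t\<close>, of i] \<open>0 \<le> K\<close>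
        by (intro mult_nonneg_nonpos) (auto intro: order_trans)
      moreover have "\<sigma> c * velocity i t \<le> 0"
      proof (cases c)
        case True
        \<comment> \<open>Competitors of the same sign suffice: the common term
          \<open>K * V (y t)\<close> cancels in the comparison.\<close>
        then have "y t $ j - x0 $ j \<le> y t $ i - x0 $ i" for j
          using max[of "(j, True)"] by (simp add: w_def k \<sigma>_def)
        then have "0 \<le> G i (y t)" using gradient_mono[of "y t" x0 i] 2 by simp
        then show ?thesis
          using velocity_nonpos control_nonpos \<open>0 \<le> t\<close> True by (simp add: \<sigma>_def)
      next
        case False
        then have "y t $ i - x0 $ i \<le> y t $ j - x0 $ j" for j
          using max[of "(j, False)"] by (simp add: w_def k \<sigma>_def)
        then have "G i (y t) \<le> 0" using gradient_antimono[of "y t" i x0] 2 by simp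
        then show ?thesis
          using velocity_nonneg control_nonneg \<open>0 \<le> t\<close> False by (simp add: \<sigma>_def)
      qed
      ultimately show ?thesis by simp
    qed
    then show "w' k t \<le> 0" by (simp add: w'_def k)
  next
    fix k :: "'n \<times> bool"
    show "w k s \<le> B + K * V (y s)"
      using init[of "fst k"] by (auto simp: w_def split_def \<sigma>_def)
  qed (use assms y_ac N in auto)
  from this[of "(i, True)"] this[of "(i, False)"] show ?thesis
    by (simp add: w_def \<sigma>_def)
qed

section \<open>Boundedness and convergence\<close>

lemma trajectory_bounded: "\<exists>R. \<forall>t\<ge>0. norm (y t) \<le> R"
proof -
  obtain x0 where x0: "\<And>i. G i x0 = 0" using equilibrium_exists by blast
  define B where "B = infnorm (y 0 - x0)"
  have "norm (y t) \<le> norm x0 + real CARD('n) * B" if "t \<ge> 0" for t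
  proof -
    \<comment> \<open>With \<open>K = 0\<close> the potential drops out, and the equilibrium
      satisfies the second alternative for all agents, so the maximal coordinate distance to
      \<open>x0\<close> never exceeds its initial value.\<close>
    have "\<bar>(y t - x0) $ i\<bar> \<le> B" for i
      using max_principle[of 0 t 0 x0 B i] that x0 component_le_infnorm_cart[of "y 0 - x0"]
      by (simp add: B_def)
    then have "norm (y t - x0) \<le> real CARD('n) * B"
      by (intro order_trans[OF norm_le_l1_cart] sum_bounded_above[of UNIV, simplified]) auto
    then show ?thesis using norm_triangle_sub[of "y t" x0] by simp
  qed
  then show ?thesis by blast
qed

text \<open>Each component that is nonzero at \<open>x0\<close> keeps, by continuity, at least half
  of its absolute value near \<open>x0\<close>; the others satisfy the second alternative.\<close>

lemma gradient_nonzero_nearby: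
  obtains K \<rho> where "K \<ge> 0" "\<rho> > 0"
    "\<And>x i. infnorm (x - x0) \<le> \<rho> \<Longrightarrow> 1 \<le> K * \<bar>G i x\<bar> \<or> G i x0 = 0"
proof -
  \<comment> \<open>A sum of nonnegative terms dominates each of them; terms with
    \<open>G i x0 = 0\<close> are 0 by the convention for division by 0.\<close>
  define K where "K = (\<Sum>i\<in>UNIV. 2 / \<bar>G i x0\<bar>)"
  have K: "2 / \<bar>G i x0\<bar> \<le> K" for i
    unfolding K_def by (rule member_le_sum) auto
  have "\<forall>\<^sub>F x in nhds x0. G i x0 \<noteq> 0 \<longrightarrow> \<bar>G i x0\<bar> / 2 < \<bar>G i x\<bar>" for i
  proof (cases "G i x0 = 0")
    case False
    have "isCont (G i) x0"
      using continuous_gradient continuous_on_eq_continuous_at by blast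
    then have "((\<lambda>x. \<bar>G i x\<bar>) \<longlongrightarrow> \<bar>G i x0\<bar>) (nhds x0)"
      by (intro tendsto_intros) (simp add: continuous_at tendsto_at_iff_tendsto_nhds)
    from order_tendstoD(1)[OF this, of "\<bar>G i x0\<bar> / 2"] False show ?thesis by simp
  qed simp
  then have "\<forall>\<^sub>F x in nhds x0. \<forall>i. G i x0 \<noteq> 0 \<longrightarrow> \<bar>G i x0\<bar> / 2 < \<bar>G i x\<bar>"
    by (rule eventually_all_finite)
  then obtain d where "d > 0" and d: "\<And>x i. dist x x0 < d \<Longrightarrow> G i x0 \<noteq> 0 \<Longrightarrow> \<bar>G i x0\<bar> / 2 < \<bar>G i x\<bar>"
    unfolding eventually_nhds_metric by blast
  \<comment> \<open>The factor that bounds the Euclidean norm by \<open>infnorm\<close>. Halving the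
    radius below turns the non-strict bound into the strict \<open>dist x x0 < d\<close>.\<close>
  define C where "C = sqrt (real DIM(real ^ 'n))"
  have "C > 0" by (simp add: C_def)
  show ?thesis
  proof (rule that[of K "d / (2 * C)"])
    show "K \<ge> 0" unfolding K_def by (intro sum_nonneg) auto
    show "d / (2 * C) > 0" using \<open>d > 0\<close> \<open>C > 0\<close> by simp
    fix x i assume "infnorm (x - x0) \<le> d / (2 * C)"
    then have "C * infnorm (x - x0) < d" using \<open>C > 0\<close> \<open>d > 0\<close> by (simp add: field_simps)
    then have "dist x x0 < d"
      using norm_le_infnorm[of "x - x0"] by (simp add: dist_norm C_def)
    show "1 \<le> K * \<bar>G i x\<bar> \<or> G i x0 = 0"
    proof (cases "G i x0 = 0")
      case False
      have "1 = 2 / \<bar>G i x0\<bar> * (\<bar>G i x0\<bar> / 2)" using False by simp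
      also have "\<dots> \<le> K * \<bar>G i x\<bar>"
        using K[of i] d[OF \<open>dist x x0 < d\<close> False] by (intro mult_mono) (auto intro: order_trans[rotated])
      finally show ?thesis by simp
    qed simp
  qed
qed

lemma trajectory_converges: "\<exists>x0. (y \<longlongrightarrow> x0) at_top"
proof -
  obtain R where "\<forall>t\<ge>0. norm (y t) \<le> R" using trajectory_bounded by blast
  then have "bounded (range (\<lambda>n. y (real n)))" by (intro boundedI[of _ R]) auto
  from bounded_imp_convergent_subsequence[OF this] obtain x0 r
    where r: "strict_mono r" and lim: "(\<lambda>n. y (real (r n))) \<longlonglongrightarrow> x0"
    unfolding o_def by blast
  have V_lim: "(\<lambda>n. V (y (real (r n)))) \<longlonglongrightarrow> V x0"
    using continuous_potential lim continuous_on_tendsto_compose[of UNIV V] by simp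
  \<comment> \<open>\<open>V\<close> is nonincreasing along \<open>y\<close>, so its limit along the
    subsequence is a lower bound. This makes \<open>K * (V (y t) - V x0)\<close> a nonnegative
    budget for further motion.\<close>
  have V_ge: "V x0 \<le> V (y t)" if "0 \<le> t" for t
  proof (rule LIMSEQ_le_const2[OF V_lim], intro exI[of _ "nat \<lceil>t\<rceil>"] allI impI)
    fix n assume "nat \<lceil>t\<rceil> \<le> n"
    then have "t \<le> real (r n)" using seq_suble[OF r, of n] by linarith
    with that show "V (y (real (r n))) \<le> V (y t)" by (rule V_antimono)
  qed
  obtain K \<rho> where K: "K \<ge> 0" "\<rho> > 0"
    "\<And>x i. infnorm (x - x0) \<le> \<rho> \<Longrightarrow> 1 \<le> K * \<bar>G i x\<bar> \<or> G i x0 = 0"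
    using gradient_nonzero_nearby by blast
  have near: "\<exists>s\<ge>0. \<forall>T\<ge>s. infnorm (y T - x0) < \<epsilon>" if "0 < \<epsilon>" "\<epsilon> \<le> \<rho>" for \<epsilon>
  proof -
    \<comment> \<open>Distance plus budget tends to 0 along the subsequence. From a time
      \<open>s\<close> at which it is below \<open>\<epsilon>\<close>, \<open>max_principle\<close>
      bounds it by its value at \<open>s\<close> as long as \<open>y\<close> stays within
      \<open>\<epsilon> \<le> \<rho>\<close>, and \<open>first_exit\<close> shows that
      \<open>y\<close> never leaves.\<close>
    have "(\<lambda>n. infnorm (y (real (r n)) - x0) + K * (V (y (real (r n))) - V x0)) \<longlonglongrightarrow> infnorm (x0 - x0) + K * (V x0 - V x0)"
      by (intro tendsto_intros tendsto_infnorm lim V_lim)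
    then have "\<forall>\<^sub>F n in sequentially. infnorm (y (real (r n)) - x0) + K * (V (y (real (r n))) - V x0) < \<epsilon>"
      using \<open>0 < \<epsilon>\<close> by (auto simp: infnorm_0 dest: order_tendstoD(2))
    then obtain s where s: "0 \<le> s" "infnorm (y s - x0) + K * (V (y s) - V x0) < \<epsilon>"
      unfolding eventually_sequentially by (metis of_nat_0_le_iff order_refl)
    have "infnorm (y T - x0) < \<epsilon>" if "s \<le> T" for T
    proof (rule first_exit[OF that])
      show "continuous_on {s..T} (\<lambda>t. infnorm (y t - x0))"
        using y_cont[OF s(1), of T] by (intro continuous_intros)
      show "infnorm (y s - x0) < \<epsilon>"
        using s(2) mult_nonneg_nonneg[OF K(1), of "V (y s) - V x0"] V_ge[OF s(1)] by simp
      fix t assume t: "t \<in> {s..T}" and stay: "\<And>r. r \<in> {s..t} \<Longrightarrow> infnorm (y r - x0) \<le> \<epsilon>"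
      have "\<bar>(y t - x0) $ i\<bar> \<le> infnorm (y s - x0) + K * (V (y s) - V x0)" for i
      proof -
        have "\<bar>y t $ i - x0 $ i\<bar> + K * V (y t) \<le> infnorm (y s - x0) + K * V (y s)"
        proof (rule max_principle)
          show "1 \<le> K * \<bar>G j (y r)\<bar> \<or> G j x0 = 0" if "r \<in> {s..t}" for r j
            using stay[OF that] \<open>\<epsilon> \<le> \<rho>\<close> by (intro K(3)) simp
          show "\<bar>y s $ j - x0 $ j\<bar> \<le> infnorm (y s - x0)" for j
            using component_le_infnorm_cart[of "y s - x0" j] by simp
        qed (use s t K in auto)
        moreover have "K * V x0 \<le> K * V (y t)"
          using V_ge[of t] s(1) t K(1) by (intro mult_left_mono) auto
        ultimately show ?thesis by (simp add: algebra_simps)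
      qed
      then show "infnorm (y t - x0) < \<epsilon>"
        using s(2) infnorm_le_cart[of "y t - x0"] by (meson order_le_less_trans)
    qed
    with s(1) show ?thesis by blast
  qed
  have "((\<lambda>t. y t $ i) \<longlongrightarrow> x0 $ i) at_top" for i
  proof (rule tendstoI)
    fix e :: real assume "e > 0"
    then obtain s where "\<And>T. T \<ge> s \<Longrightarrow> infnorm (y T - x0) < min e \<rho>"
      using near[of "min e \<rho>"] K(2) by auto
    then have "dist (y T $ i) (x0 $ i) < e" if "T \<ge> s" for T
      using that component_le_infnorm_cart[of "y T - x0" i] by (fastforce simp: dist_real_def)
    then show "\<forall>\<^sub>F t in at_top. dist (y t $ i) (x0 $ i) < e"
      unfolding eventually_at_top_linorder by blast
  qed
  then have "(y \<longlongrightarrow> x0) at_top" by (rule vec_tendstoI)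
  then show ?thesis by blast
qed

section \<open>Membership of the limit in \<open>Sp\<close>\<close>

lemma no_persistent_control:
  assumes active: "recurrently_active (h i) (u i)"
    and lim: "((\<lambda>t. y t $ i) \<longlongrightarrow> l) at_top"
    and "c > 0" and \<sigma>: "\<sigma> = 1 \<or> \<sigma> = - 1"
    and push: "\<forall>\<^sub>F t in at_top. c \<le> \<sigma> * u i t"
  shows False
proof -
  obtain \<alpha> \<tau> \<J> where "\<alpha> > 0" "\<tau> > 0" "infinite \<J>" "disjoint \<J>"
    and \<J>: "\<And>J. J \<in> \<J> \<Longrightarrow> is_interval J \<and> J \<subseteq> {0..} \<and> ennreal \<tau> \<le> emeasure lborel J"
    and act: "\<And>J t. J \<in> \<J> \<Longrightarrow> t \<in> J \<Longrightarrow> \<alpha> * \<bar>u i t\<bar> \<le> \<bar>velocity i t\<bar>"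
    using active unfolding recurrently_active_def velocity_def by metis
  \<comment> \<open>A lower bound for the speed in late active slots: within one of length
    \<open>\<tau> / 2\<close> agent \<open>i\<close> covers at least \<open>m * \<tau> / 2\<close>,
    whereas two late positions, each within \<open>m * \<tau> / 4\<close> of the limit, differ by
    less.\<close>
  define m where "m = \<alpha> * c"
  have "m > 0" using \<open>\<alpha> > 0\<close> \<open>c > 0\<close> by (simp add: m_def)
  have "\<forall>\<^sub>F t in at_top. dist (y t $ i) l < m * \<tau> / 4"
    using lim \<open>m > 0\<close> \<open>\<tau> > 0\<close> by (intro tendstoD) auto
  with push have "\<forall>\<^sub>F t in at_top. c \<le> \<sigma> * u i t \<and> dist (y t $ i) l < m * \<tau> / 4"
    by (rule eventually_conj)
  then obtain T where T: "\<And>t. t \<ge> T \<Longrightarrow> c \<le> \<sigma> * u i t" "\<And>t. t \<ge> T \<Longrightarrow> dist (y t $ i) l < m * \<tau> / 4"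
    unfolding eventually_at_top_linorder by blast
  obtain a J where a: "a \<ge> max T 0" "J \<in> \<J>" "{a..a + \<tau> / 2} \<subseteq> J"
    using disjoint_intervals_escape[OF \<open>infinite \<J>\<close> \<open>disjoint \<J>\<close> \<open>\<tau> > 0\<close> \<J>] by blast
  define b where "b = a + \<tau> / 2"
  have speed: "m \<le> \<sigma> * velocity i t" if "t \<in> {a..b}" for t
  proof -
    have t: "t \<ge> T" "t \<ge> 0" "t \<in> J" using that a by (auto simp: b_def)
    have "m \<le> \<alpha> * \<bar>u i t\<bar>"
      unfolding m_def using T(1)[OF t(1)] \<sigma> \<open>\<alpha> > 0\<close> by (intro mult_left_mono) auto
    also have "\<dots> \<le> \<bar>velocity i t\<bar>" using act[OF a(2) t(3)] .
    \<comment> \<open>The control has the sign of \<open>\<sigma>\<close>, and the velocity does not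
      oppose the control.\<close>
    also have "\<dots> = \<sigma> * velocity i t"
      using \<sigma> T(1)[OF t(1)] \<open>c > 0\<close> velocity_nonpos[OF t(2), of i] velocity_nonneg[OF t(2), of i] by auto
    finally show ?thesis .
  qed
  have "0 \<le> a" using a(1) by simp
  obtain N where N: "N \<in> null_sets lborel" and der: "\<And>i t. t \<in> {a..b} - N \<Longrightarrow>
      ((\<lambda>t. y t $ i) has_real_derivative velocity i t) (at t within {a..b})"
    using y_deriv \<open>0 \<le> a\<close> by metis
  \<comment> \<open>In place of the mean value theorem: \<open>m * t - \<sigma> * y t $ i\<close>
    has a nonpositive derivative almost everywhere.\<close>
  have "m * b - \<sigma> * y b $ i \<le> m * a - \<sigma> * y a $ i"
  proof (rule absolutely_continuous_max_descent[of a b y "\<lambda>_::unit. \<lambda>t. m * t - \<sigma> * y t $ i" "1 + m" N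
        "\<lambda>_ t. m - \<sigma> * velocity i t"])
    fix s t assume "s \<in> {a..b}" "t \<in> {a..b}"
    have "\<bar>(m * t - \<sigma> * y t $ i) - (m * s - \<sigma> * y s $ i)\<bar> \<le> m * \<bar>t - s\<bar> + \<bar>y t $ i - y s $ i\<bar>"
    proof -
      have "(m * t - \<sigma> * y t $ i) - (m * s - \<sigma> * y s $ i) = m * (t - s) - \<sigma> * (y t $ i - y s $ i)"
        by (simp add: algebra_simps)
      also have "\<bar>\<dots>\<bar> \<le> \<bar>m * (t - s)\<bar> + \<bar>\<sigma> * (y t $ i - y s $ i)\<bar>" by (rule abs_triangle_ineq4)
      finally show ?thesis using \<open>m > 0\<close> \<sigma> by (auto simp: abs_mult)
    qed
    also have "\<dots> \<le> (1 + m) * \<bar>t - s\<bar> + (1 + m) * norm (y t - y s)"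
    proof (rule add_mono)
      have "\<bar>y t $ i - y s $ i\<bar> \<le> 1 * norm (y t - y s)"
        using component_le_norm_cart[of "y t - y s" i] by simp
      also have "\<dots> \<le> (1 + m) * norm (y t - y s)"
        using \<open>m > 0\<close> by (intro mult_right_mono) auto
      finally show "\<bar>y t $ i - y s $ i\<bar> \<le> (1 + m) * norm (y t - y s)" .
    qed (simp add: distrib_right)
    finally show "\<bar>(m * t - \<sigma> * y t $ i) - (m * s - \<sigma> * y s $ i)\<bar> \<le> (1 + m) * (norm (y t - y s) + \<bar>t - s\<bar>)"
      by (simp add: distrib_left)
  next
    fix t assume t: "t \<in> {a..b} - N"
    show "((\<lambda>t. m * t - \<sigma> * y t $ i) has_real_derivative m - \<sigma> * velocity i t) (at t within {a..b})"
      using der[OF t] by (auto intro!: derivative_eq_intros)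
    show "m - \<sigma> * velocity i t \<le> 0" using speed[of t] t by simp
  qed (use N y_ac \<open>0 \<le> a\<close> \<open>\<tau> > 0\<close> in \<open>auto simp: b_def\<close>)
  then have "m * \<tau> / 2 \<le> \<sigma> * (y b $ i - y a $ i)"
    by (simp add: b_def algebra_simps)
  also have "\<dots> \<le> \<bar>y b $ i - y a $ i\<bar>" using \<sigma> by auto
  also have "\<dots> < m * \<tau> / 2"
  proof -
    have "T \<le> a" "T \<le> b" using a(1) \<open>\<tau> > 0\<close> by (auto simp: b_def)
    then show ?thesis using T(2)[of a] T(2)[of b] unfolding dist_real_def by linarith
  qed
  finally show False by simp
qed

text \<open>A violated inequality at the limit would make the control of agent \<open>i\<close> push
  persistently in one direction, which \<open>no_persistent_control\<close> excludes.\<close>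

lemma limit_in_Sp:
  assumes active: "\<And>i. recurrently_active (h i) (u i)"
    and lim: "(y \<longlongrightarrow> x0) at_top"
  shows "x0 \<in> Sp nbr f pbar"
proof -
  have cont: "continuous_on UNIV (gt_minus nbr f pbar i)" "continuous_on UNIV (gt_plus nbr f pbar i)" for i
    unfolding gt_minus_def gt_plus_def
    by (intro continuous_intros continuous_on_compose2[OF f'_cont]; auto)+
  have tends: "((\<lambda>t. gt_minus nbr f pbar i (y t)) \<longlongrightarrow> gt_minus nbr f pbar i x0) at_top"
    "((\<lambda>t. gt_plus nbr f pbar i (y t)) \<longlongrightarrow> gt_plus nbr f pbar i x0) at_top" for i
    using continuous_on_tendsto_compose[OF cont(1) lim] continuous_on_tendsto_compose[OF cont(2) lim] by auto
  have "gt_minus nbr f pbar i x0 \<le> 0" for i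
  proof (rule ccontr)
    assume neg: "\<not> ?thesis"
    \<comment> \<open>Half of the positive limit value is a margin that \<open>gt_minus\<close>
      along \<open>y\<close> eventually exceeds.\<close>
    define c where "c = gt_minus nbr f pbar i x0 / 2"
    have "c > 0" "c < gt_minus nbr f pbar i x0" using neg by (auto simp: c_def)
    have "\<forall>\<^sub>F t in at_top. c < gt_minus nbr f pbar i (y t) \<and> 0 \<le> t"
      using order_tendstoD(1)[OF tends(1) \<open>c < _\<close>] eventually_ge_at_top[of 0] by (rule eventually_conj)
    then have "\<forall>\<^sub>F t in at_top. c \<le> - 1 * u i t"
    proof eventually_elim
      case (elim t)
      \<comment> \<open>Here \<open>g_plus \<ge> g_minus > c > 0\<close>, so the control is exactly
        the negative of \<open>g_minus\<close>.\<close>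
      with gt_minus_le[of t i] g_minus_le[of t i] g_plus_ge[of t i] \<open>c > 0\<close>
      show ?case by (simp add: control_def)
    qed
    with no_persistent_control[OF active tendsto_vec_nth[OF lim] \<open>c > 0\<close>] show False by blast
  qed
  moreover have "0 \<le> gt_plus nbr f pbar i x0" for i
  proof (rule ccontr)
    assume neg: "\<not> ?thesis"
    define c where "c = - gt_plus nbr f pbar i x0 / 2"
    have "c > 0" "gt_plus nbr f pbar i x0 < - c" using neg by (auto simp: c_def)
    have "\<forall>\<^sub>F t in at_top. gt_plus nbr f pbar i (y t) < - c \<and> 0 \<le> t"
      using order_tendstoD(2)[OF tends(2) \<open>_ < - c\<close>] eventually_ge_at_top[of 0] by (rule eventually_conj)
    then have "\<forall>\<^sub>F t in at_top. c \<le> 1 * u i t"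
    proof eventually_elim
      case (elim t)
      with gt_plus_ge[of t i] g_minus_le[of t i] g_plus_ge[of t i] \<open>c > 0\<close>
      show ?case by (simp add: control_def)
    qed
    with no_persistent_control[OF active tendsto_vec_nth[OF lim] \<open>c > 0\<close>] show False by blast
  qed
  ultimately show ?thesis by (simp add: Sp_def Sp_agent_def)
qed

end

theorem proposition7:
  fixes nbr :: "'n::finite \<Rightarrow> 'n \<Rightarrow> bool"
    and f :: "'n \<Rightarrow> 'n \<Rightarrow> real \<Rightarrow> real"
    and pbar :: "'n \<Rightarrow> 'n \<Rightarrow> real"
    and h :: "'n \<Rightarrow> real \<Rightarrow> real \<Rightarrow> real"
    and p :: "'n \<Rightarrow> 'n \<Rightarrow> real \<Rightarrow> real"
    and y :: "real \<Rightarrow> real ^ 'n"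
  assumes graph: "connected_simple_graph nbr"
    and f_diff: "\<And>i j. nbr i j \<Longrightarrow> f i j differentiable_on UNIV"
    and f_diff2: "\<And>i j. nbr i j \<Longrightarrow> deriv (f i j) differentiable_on UNIV"
    and f_lip: "\<And>i j. nbr i j \<Longrightarrow> locally_lipschitz (deriv (deriv (f i j)))"
    and f_sym: "\<And>i j z. nbr i j \<Longrightarrow> f i j z = f j i (- z)"
    and pbar_nonneg: "\<And>i j. nbr i j \<Longrightarrow> 0 \<le> pbar i j"
    and h_sign: "\<And>i. sign_preserving (h i)"
    and f_convex: "\<And>i j. nbr i j \<Longrightarrow> locally_strongly_convex (f i j)"
    and f_min: "\<And>i j. nbr i j \<Longrightarrow> admits_minimum (f i j)"
    and f_nonneg: "\<And>i j z. nbr i j \<Longrightarrow> 0 \<le> f i j z"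
    and traj: "trajectory nbr f pbar h p y"
    and active: "\<And>i. recurrently_active (h i) (control nbr f pbar p y i)"
  shows "\<exists>x. (y \<longlongrightarrow> x) at_top \<and> x \<in> Sp nbr f pbar"
proof -
  interpret perturbed_system nbr f pbar h p y
    by unfold_locales (use assms in auto)
  from trajectory_converges limit_in_Sp active show ?thesis by blast
qed

end
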